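(* Let $\mu>0$, $\alpha<0$, $\lambda>0$, let $j\ge1$ be an integer, and let $\{\mathbb{S}_n\}_{n\ge0}$ be the monic Charlier–Sobolev type orthogonal polynomials. Then, uniformly for $z$ in compact subsets of $\mathbb{C}$, $$\lim_{n\to\infty}\frac{(-1)^n\,n}{\Gamma(n-z)}\,\mathbb{S}_n(z)=-(z-\alpha)\,\frac{e^{\mu}}{\Gamma(-z)}.$$ The limit is independent of $\lambda$ and $j$.
   Context: $\Delta f(x)=f(x+1)-f(x)$ and $\Delta^j$ is its $j$-fold iterate. The monic Charlier–Sobolev type polynomials $\mathbb{S}_n$ ($\deg \mathbb{S}_n=n$, leading coefficient $1$) are the polynomials orthogonal with respect to the inner product on real polynomials $$\langle f,g\rangle_\lambda=\sum_{x=0}^{\infty}f(x)g(x)\,\frac{e^{-\mu}\mu^x}{\Gamma(x+1)}+\lambda\,\Delta^jf(\alpha)\,\Delta^jg(\alpha).$$ The functions $1/\Gamma(n-z)$ and $1/\Gamma(-z)$ are understood as entire functions of $z$. *)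

theory Defs
  imports "HOL-Analysis.Analysis" "HOL-Computational_Algebra.Polynomial"
begin

definition fwd_diff :: "(real \<Rightarrow> real) \<Rightarrow> real \<Rightarrow> real" where
  "fwd_diff f x = f (x + 1) - f x"

text \<open>The series converges absolutely for all polynomials, so \<open>suminf\<close> is its actual sum.\<close>

definition charlier_sobolev_inner ::
  "real \<Rightarrow> real \<Rightarrow> real \<Rightarrow> nat \<Rightarrow> real poly \<Rightarrow> real poly \<Rightarrow> real" where
  "charlier_sobolev_inner \<mu> \<alpha> lam j f g =
     (\<Sum>x. poly f (real x) * poly g (real x) * (exp (- \<mu>) * \<mu> ^ x / Gamma (real x + 1)))
     + lam * (fwd_diff ^^ j) (poly f) \<alpha> * (fwd_diff ^^ j) (poly g) \<alpha>"

definition monic_orthogonal_seq ::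
  "(real poly \<Rightarrow> real poly \<Rightarrow> real) \<Rightarrow> (nat \<Rightarrow> real poly) \<Rightarrow> bool" where
  "monic_orthogonal_seq ip S \<longleftrightarrow>
     (\<forall>n. degree (S n) = n \<and> lead_coeff (S n) = 1) \<and>
     (\<forall>m n. m \<noteq> n \<longrightarrow> ip (S m) (S n) = 0)"

end

theory Submission imports Defs "HOL-Real_Asymp.Real_Asymp"
begin

text \<open>
Let \<open>C\<^sub>n\<close> be the monic Charlier polynomials, \<open>h\<^sub>k = k! \<mu>\<^sup>k\<close> their squared norms and
\<open>b\<^sub>k = \<Delta>\<^sup>j C\<^sub>k(\<alpha>)\<close>. Orthogonality to all lower degrees determines \<open>S\<^sub>n\<close> up to the
number \<open>\<Delta>\<^sup>j S\<^sub>n(\<alpha>)\<close>, which solves a linear equation; this gives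
\<open>S\<^sub>n = C\<^sub>n - b\<^sub>n K\<^sub>n / D\<^sub>n\<close> with \<open>K\<^sub>n = (\<Sum>k<n. b\<^sub>k / h\<^sub>k C\<^sub>k)\<close> and
\<open>D\<^sub>n = 1 / \<lambda> + (\<Sum>k<n. b\<^sub>k\<^sup>2 / h\<^sub>k)\<close> (\<open>charlier_sobolev_kernel_formula\<close>).

Because \<open>\<alpha> < 0\<close>, the \<open>b\<^sub>k\<close> with \<open>k \<ge> j\<close> do not vanish, and \<open>b\<^sub>k\<^sup>2\<close> outgrows \<open>h\<^sub>k\<close>
by a factor of about \<open>k / \<mu>\<close> per step. Both sums are therefore dominated by their last terms. Keeping
only these would give \<open>S\<^sub>n\<^sub>+\<^sub>1 \<approx> C\<^sub>n\<^sub>+\<^sub>1 + e\<^sub>n C\<^sub>n\<close> with \<open>e\<^sub>n = - b\<^sub>n\<^sub>+\<^sub>1 / b\<^sub>n\<close>. In terms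
of the scaled polynomials \<open>A\<^sub>n(z) = (-1)\<^sup>n C\<^sub>n(z) / \<Gamma>(n - z)\<close> the right-hand side is
\<open>A\<^sub>n\<^sub>+\<^sub>1 - e\<^sub>n / (n - z) A\<^sub>n\<close>. Now \<open>A\<^sub>n\<close> tends to \<open>exp \<mu> / \<Gamma>(-z)\<close> with increments
\<open>o(1/n)\<close> (\<open>scaled_charlier_limit\<close>, \<open>scaled_charlier_increment_null\<close>), and \<open>e\<^sub>n = n - \<alpha> + o(1)\<close>
(\<open>diff_ratio_asymptotics\<close>), so \<open>n\<close> times this expression tends to
\<open>(\<alpha> - z) exp \<mu> / \<Gamma>(-z)\<close>.

Since the result lives at order \<open>1/n\<close>, the rest of the two sums cannot simply be dropped: relative to the
last terms it has size \<open>\<mu> / n\<close>. But this correction is the same in \<open>K\<^sub>n\<close> and in \<open>D\<^sub>n\<close>, so it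
cancels in the quotient. To see this, each sum is divided by its last term; the quotients satisfy
recurrences \<open>x\<^sub>n\<^sub>+\<^sub>1 = a\<^sub>n\<^sub>+\<^sub>1 + \<rho>\<^sub>n x\<^sub>n\<close> with \<open>n \<rho>\<^sub>n \<rightarrow> \<mu>\<close>, from which the correction can be
read off (\<open>uniform_limit_perturbed_recurrence\<close>, \<open>scaled_kernel_limit\<close>, \<open>scaled_diag_limit\<close>).

The limit of \<open>A\<^sub>n\<close> comes from the explicit sum for \<open>C\<^sub>n\<close>: in the half-plane \<open>Re z \<le> -1\<close> its terms
admit a uniform majorant, so that one may pass to the limit termwise. From there the relation
\<open>\<Delta> C\<^sub>n = n C\<^sub>n\<^sub>-\<^sub>1\<close> propagates the convergence to the right by unit steps, in accordance with
the functional equation of \<open>1 / \<Gamma>(-z)\<close>.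
\<close>

section \<open>Charlier polynomials\<close>

text \<open>The three-term recurrence is the definition because it makes sense over every field and commutes with
the passage from real to complex coefficients. For \<open>n = 0\<close> its last summand has the
factor \<open>0\<close>, so the truncated subtraction is harmless.\<close>

fun charlier :: "'a::field_char_0 \<Rightarrow> nat \<Rightarrow> 'a poly" where
  "charlier \<mu> 0 = 1"
| "charlier \<mu> (Suc n) =
     [:- (of_nat n + \<mu>), 1:] * charlier \<mu> n - smult (of_nat n * \<mu>) (charlier \<mu> (n - 1))"

lemma charlier_monic: "degree (charlier \<mu> n) = n \<and> lead_coeff (charlier \<mu> n) = 1"
proof -
  have "degree (charlier \<mu> n) \<le> n \<and> coeff (charlier \<mu> n) n = 1"
  proof (induction n rule: less_induct)
    case (less n)
    show ?case
    proof (cases n)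
      case (Suc k)
      have deg_k: "degree (charlier \<mu> k) \<le> k" and lc_k: "coeff (charlier \<mu> k) k = 1"
        using less.IH[of k] Suc by auto
      have deg_pred: "degree (smult (of_nat k * \<mu>) (charlier \<mu> (k - 1))) \<le> k"
        using less.IH[of "k - 1"] Suc by (metis degree_smult_le diff_le_self le_trans less_Suc_eq_le)
      have "degree ([:- (of_nat k + \<mu>), 1:] * charlier \<mu> k) \<le> Suc k"
        using deg_k by (intro order.trans[OF degree_mult_le]) auto
      moreover have "coeff ([:- (of_nat k + \<mu>), 1:] * charlier \<mu> k) (Suc k) = 1"
        using deg_k lc_k by (simp add: coeff_eq_0)
      moreover have "coeff (smult (of_nat k * \<mu>) (charlier \<mu> (k - 1))) (Suc k) = 0"
        using deg_pred by (intro coeff_eq_0) auto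
      ultimately show ?thesis
        using deg_pred unfolding Suc charlier.simps coeff_diff by (auto intro!: degree_diff_le)
    qed simp
  qed
  then show ?thesis
    by (metis le_degree order_antisym zero_neq_one)
qed

lemmas degree_charlier = charlier_monic[THEN conjunct1]

lemma map_poly_charlier:
  "map_poly complex_of_real (charlier \<mu> n) = charlier (complex_of_real \<mu>) n"
proof (induction n rule: less_induct)
  case (less n)
  show ?case
  proof (cases n)
    case (Suc k)
    have "map_poly complex_of_real (charlier \<mu> (Suc k)) =
        [:- (of_nat k + complex_of_real \<mu>), 1:] * map_poly complex_of_real (charlier \<mu> k)
        - smult (of_nat k * complex_of_real \<mu>) (map_poly complex_of_real (charlier \<mu> (k - 1)))"
      by (intro poly_eqI) (auto simp: coeff_map_poly coeff_pCons algebra_simps split: nat.splits)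
    then show ?thesis
      using less.IH[of k] less.IH[of "k - 1"] Suc by simp
  qed simp
qed

lemma poly_charlier_Suc:
  "poly (charlier \<mu> (Suc n)) x =
     (x - of_nat n - \<mu>) * poly (charlier \<mu> n) x - of_nat n * \<mu> * poly (charlier \<mu> (n - 1)) x"
  by (simp add: algebra_simps)

lemma charlier_forward_difference:
  "poly (charlier \<mu> n) (x + 1) - poly (charlier \<mu> n) x = of_nat n * poly (charlier \<mu> (n - 1)) x"
proof (induction n rule: less_induct)
  case (less n)
  show ?case
  proof (cases n)
    case (Suc k)
    define c where "c i = poly (charlier \<mu> i)" for i
    have step: "c k (x + 1) = c k x + of_nat k * c (k - 1) x"
      and step': "c (k - 1) (x + 1) = c (k - 1) x + of_nat (k - 1) * c (k - 2) x"
      using less.IH[of k] less.IH[of "k - 1"] Suc by (auto simp: c_def algebra_simps numeral_2_eq_2)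
    have rec: "c (Suc i) y = (y - of_nat i - \<mu>) * c i y - of_nat i * \<mu> * c (i - 1) y" for i y
      unfolding c_def by (rule poly_charlier_Suc)
    show ?thesis
    proof (cases k)
      case 0
      then show ?thesis using Suc by simp
    next
      case (Suc l)
      have "c (Suc k) (x + 1) - c (Suc k) x = of_nat (Suc k) * c k x"
        unfolding rec[of k] step step' unfolding Suc by (simp add: rec[of l] algebra_simps)
      then show ?thesis using \<open>n = Suc k\<close> by (simp add: c_def)
    qed
  qed simp
qed

text \<open>Up to normalisation this is the action of the adjoint of the forward difference with respect to the
Poisson weight; it yields both orthogonality and the explicit sum.\<close>

lemma charlier_raising:
  "poly (charlier \<mu> (Suc n)) x = x * poly (charlier \<mu> n) (x - 1) - \<mu> * poly (charlier \<mu> n) x"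
proof (induction n)
  case (Suc n)
  have "poly (charlier \<mu> (Suc n)) (x - 1) =
      poly (charlier \<mu> (Suc n)) x - of_nat (Suc n) * poly (charlier \<mu> n) (x - 1)"
    using charlier_forward_difference[of \<mu> "Suc n" "x - 1"]
    by (simp add: algebra_simps del: charlier.simps)
  then have "x * poly (charlier \<mu> (Suc n)) (x - 1) =
      x * poly (charlier \<mu> (Suc n)) x - of_nat (Suc n) * (x * poly (charlier \<mu> n) (x - 1))"
    by (simp only: right_diff_distrib mult.left_commute)
  also have "x * poly (charlier \<mu> n) (x - 1) = poly (charlier \<mu> (Suc n)) x + \<mu> * poly (charlier \<mu> n) x"
    using Suc.IH by (simp add: algebra_simps del: charlier.simps)
  finally show ?case
    by (simp only: poly_charlier_Suc[of \<mu> "Suc n"]) (simp add: algebra_simps del: charlier.simps)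
qed simp

lemma pochhammer_shift: "x * pochhammer (1 - x) k = - pochhammer (- x) (Suc k)" for x :: "'a::field_char_0"
  by (simp add: pochhammer_rec)

lemma charlier_explicit:
  "poly (charlier \<mu> n) x = (-1) ^ n * (\<Sum>i\<le>n. of_nat (n choose i) * \<mu> ^ i * pochhammer (- x) (n - i))"
proof (induction n arbitrary: x)
  case (Suc n)
  define P where "P = pochhammer (- x)"
  have "poly (charlier \<mu> (Suc n)) x =
      (-1) ^ n * (\<Sum>i\<le>n. of_nat (n choose i) * \<mu> ^ i * - P (Suc n - i))
      - \<mu> * ((-1) ^ n * (\<Sum>i\<le>n. of_nat (n choose i) * \<mu> ^ i * P (n - i)))"
    unfolding charlier_raising Suc.IH P_def
    by (auto simp: sum_distrib_left mult_ac Suc_diff_le simp flip: pochhammer_shift intro!: sum.cong)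
  also have "\<dots> = (-1) ^ Suc n * ((\<Sum>i\<le>n. of_nat (n choose i) * \<mu> ^ i * P (Suc n - i))
      + (\<Sum>i\<le>n. of_nat (n choose i) * \<mu> ^ Suc i * P (n - i)))"
    by (simp add: sum_negf sum_distrib_left algebra_simps)
  also have "(\<Sum>i\<le>n. of_nat (n choose i) * \<mu> ^ i * P (Suc n - i)) =
      (\<Sum>i\<le>Suc n. of_nat (n choose i) * \<mu> ^ i * P (Suc n - i))"
    by simp
  also have "(\<Sum>i\<le>Suc n. of_nat (n choose i) * \<mu> ^ i * P (Suc n - i)) =
      P (Suc n) + (\<Sum>i\<le>n. of_nat (n choose Suc i) * \<mu> ^ Suc i * P (n - i))"
    by (subst sum.atMost_Suc_shift) simp
  also have "P (Suc n) + (\<Sum>i\<le>n. of_nat (n choose Suc i) * \<mu> ^ Suc i * P (n - i))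
      + (\<Sum>i\<le>n. of_nat (n choose i) * \<mu> ^ Suc i * P (n - i))
      = (\<Sum>i\<le>Suc n. of_nat (Suc n choose i) * \<mu> ^ i * P (Suc n - i))"
    by (subst sum.atMost_Suc_shift) (simp add: sum.distrib[symmetric] algebra_simps)
  finally show ?case
    unfolding P_def .
qed simp

text \<open>For a negative argument every Pochhammer symbol in the explicit sum is positive, so no cancellation
takes place; the sign of the mass point matters for this reason.\<close>

lemma charlier_negative_argument:
  fixes \<mu> x :: real
  assumes "\<mu> > 0" "x < 0"
  shows "(-1) ^ n * poly (charlier \<mu> n) x > 0"
proof -
  have "(-1) ^ n * poly (charlier \<mu> n) x =
      (\<Sum>i\<le>n. of_nat (n choose i) * \<mu> ^ i * pochhammer (- x) (n - i))"
    unfolding charlier_explicit by (simp flip: mult.assoc power_mult_distrib)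
  also have "\<dots> > 0"
    using assms by (intro sum_pos) (auto intro!: mult_pos_pos pochhammer_pos)
  finally show ?thesis .
qed

lemma fwd_diff_iter_linear:
  "(fwd_diff ^^ j) (\<lambda>x. a * f x + b * g x) = (\<lambda>x. a * (fwd_diff ^^ j) f x + b * (fwd_diff ^^ j) g x)"
  by (induction j) (auto simp: fwd_diff_def fun_eq_iff algebra_simps)

lemma fwd_diff_charlier:
  "(fwd_diff ^^ j) (poly (charlier \<mu> (i + j))) x = fact (i + j) / fact i * poly (charlier \<mu> i) x"
proof (induction j arbitrary: x)
  case (Suc j)
  have "(fwd_diff ^^ j) (\<lambda>x. c * f x) = (\<lambda>x. c * (fwd_diff ^^ j) f x)" for c f
    using fwd_diff_iter_linear[of j c f 0 f] by simp
  moreover have "fwd_diff (poly (charlier \<mu> (i + Suc j))) =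
      (\<lambda>x. real (i + Suc j) * poly (charlier \<mu> (i + j)) x)"
    using charlier_forward_difference[of \<mu> "i + Suc j"] by (simp add: fwd_diff_def fun_eq_iff)
  ultimately have "(fwd_diff ^^ Suc j) (poly (charlier \<mu> (i + Suc j))) x =
      real (i + Suc j) * (fwd_diff ^^ j) (poly (charlier \<mu> (i + j))) x"
    unfolding funpow_Suc_right by (simp del: charlier.simps)
  then show ?case
    using Suc.IH[of x] by (simp del: charlier.simps)
qed simp

lemma fwd_diff_iter_poly_linear:
  "(fwd_diff ^^ j) (poly (smult a p + smult b q)) x
     = a * (fwd_diff ^^ j) (poly p) x + b * (fwd_diff ^^ j) (poly q) x"
proof -
  have "poly (smult a p + smult b q) = (\<lambda>x. a * poly p x + b * poly q x)" by auto
  then show ?thesis by (simp add: fwd_diff_iter_linear)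
qed

section \<open>The Poisson functional and orthogonality\<close>

definition poisson_weight :: "real \<Rightarrow> nat \<Rightarrow> real" where
  "poisson_weight \<mu> x = exp (- \<mu>) * \<mu> ^ x / Gamma (real x + 1)"

definition poisson_functional :: "real \<Rightarrow> real poly \<Rightarrow> real" where
  "poisson_functional \<mu> f = (\<Sum>x. poly f (real x) * poisson_weight \<mu> x)"

lemma poisson_weight_fact: "poisson_weight \<mu> x = exp (- \<mu>) * \<mu> ^ x / fact x"
  using Gamma_fact[of x, where 'a = real] by (simp add: poisson_weight_def add.commute)

lemma poisson_weight_Suc:
  "real (Suc x) * y * poisson_weight \<mu> (Suc x) = \<mu> * (y * poisson_weight \<mu> x)"
  by (simp add: poisson_weight_fact field_simps del: of_nat_Suc)

lemma poisson_weight_sums: "poisson_weight \<mu> sums 1"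
proof -
  have "(\<lambda>x. exp (- \<mu>) * (\<mu> ^ x /\<^sub>R fact x)) sums (exp (- \<mu>) * exp \<mu>)"
    by (intro sums_mult exp_converges)
  then show ?thesis
    by (simp add: poisson_weight_fact[abs_def] field_simps exp_minus)
qed

text \<open>Induction on the degree: splitting off one factor \<open>x\<close> cancels against the factorial in the
weight and leaves a series of the same kind for a polynomial of lower degree.\<close>

lemma poisson_summable: "summable (\<lambda>x. poly f (real x) * poisson_weight \<mu> x)"
proof (induction "degree f" arbitrary: f rule: less_induct)
  case less
  obtain a q where f: "f = pCons a q" by (cases f)
  have base: "summable (\<lambda>x. a * poisson_weight \<mu> x)"
    using poisson_weight_sums by (intro summable_mult) (auto simp: sums_iff)
  show ?case
  proof (cases "q = 0")
    case True
    then show ?thesis using base f by simp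
  next
    case False
    have "summable (\<lambda>x. poly (q \<circ>\<^sub>p [:1, 1:]) (real x) * poisson_weight \<mu> x)"
      using less[of "q \<circ>\<^sub>p [:1, 1:]"] f False by (simp add: degree_pcompose)
    then have "summable (\<lambda>x. \<mu> * (poly (q \<circ>\<^sub>p [:1, 1:]) (real x) * poisson_weight \<mu> x))"
      by (rule summable_mult)
    moreover have "\<mu> * (poly (q \<circ>\<^sub>p [:1, 1:]) (real x) * poisson_weight \<mu> x) =
        real (Suc x) * poly q (real (Suc x)) * poisson_weight \<mu> (Suc x)" for x
      unfolding poisson_weight_Suc by (simp add: poly_pcompose add.commute)
    ultimately have "summable (\<lambda>x. real (Suc x) * poly q (real (Suc x)) * poisson_weight \<mu> (Suc x))"
      by simp
    then have "summable (\<lambda>x. real x * poly q (real x) * poisson_weight \<mu> x)"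
      by (subst (asm) summable_Suc_iff)
    from summable_add[OF base this] show ?thesis
      by (simp add: f algebra_simps)
  qed
qed

lemma poisson_functional_linear:
  "poisson_functional \<mu> (smult a f + smult b g) = a * poisson_functional \<mu> f + b * poisson_functional \<mu> g"
proof -
  have "poisson_functional \<mu> (smult a f + smult b g) =
     (\<Sum>x. a * (poly f (real x) * poisson_weight \<mu> x) + b * (poly g (real x) * poisson_weight \<mu> x))"
    by (simp add: poisson_functional_def algebra_simps)
  also have "\<dots> = a * poisson_functional \<mu> f + b * poisson_functional \<mu> g"
    unfolding poisson_functional_def
    by (subst suminf_add[symmetric]) (auto intro!: summable_mult poisson_summable simp: suminf_mult poisson_summable)
  finally show ?thesis .
qed

lemma poisson_functional_shift:
  "poisson_functional \<mu> ([:0, 1:] * f) = \<mu> * poisson_functional \<mu> (f \<circ>\<^sub>p [:1, 1:])"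
proof -
  define t where "t = (\<lambda>x. real x * poly f (real x) * poisson_weight \<mu> x)"
  have "summable t"
    using poisson_summable[of "[:0, 1:] * f" \<mu>] by (simp add: t_def)
  then have "poisson_functional \<mu> ([:0, 1:] * f) = (\<Sum>x. t (Suc x))"
    using suminf_split_head[of t] by (simp add: poisson_functional_def t_def)
  also have "(\<lambda>x. t (Suc x)) = (\<lambda>x. \<mu> * (poly (f \<circ>\<^sub>p [:1, 1:]) (real x) * poisson_weight \<mu> x))"
    unfolding t_def poisson_weight_Suc by (simp add: poly_pcompose add.commute)
  also have "suminf \<dots> = \<mu> * poisson_functional \<mu> (f \<circ>\<^sub>p [:1, 1:])"
    unfolding poisson_functional_def by (simp add: suminf_mult poisson_summable)
  finally show ?thesis .
qed

text \<open>The raising formula expresses the next Charlier polynomial by the backward shift of the previous one,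
and under the functional the factor \<open>x\<close> in front of it turns that shift into a forward shift of
\<open>g\<close>.\<close>

lemma charlier_adjoint:
  fixes \<mu> :: real
  shows "poisson_functional \<mu> (charlier \<mu> (Suc n) * g) =
    \<mu> * poisson_functional \<mu> (charlier \<mu> n * (g \<circ>\<^sub>p [:1, 1:] - g))"
proof -
  define q where "q = (charlier \<mu> n \<circ>\<^sub>p [:-1, 1:]) * g"
  have "charlier \<mu> (Suc n) * g = smult 1 ([:0, 1:] * q) + smult (- \<mu>) (charlier \<mu> n * g)"
    unfolding poly_eq_poly_eq_iff[symmetric]
    by (rule ext, simp only: poly_mult charlier_raising q_def) (simp add: poly_pcompose algebra_simps)
  moreover have "q \<circ>\<^sub>p [:1, 1:] = charlier \<mu> n * (g \<circ>\<^sub>p [:1, 1:])"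
    unfolding poly_eq_poly_eq_iff[symmetric] by (rule ext) (simp add: q_def poly_pcompose)
  moreover have "charlier \<mu> n * (g \<circ>\<^sub>p [:1, 1:] - g) =
      smult 1 (charlier \<mu> n * (g \<circ>\<^sub>p [:1, 1:])) + smult (- 1) (charlier \<mu> n * g)"
    by (simp add: algebra_simps)
  ultimately show ?thesis
    by (simp only: poisson_functional_linear poisson_functional_shift) (simp add: algebra_simps)
qed

text \<open>Each application of the adjoint relation lowers both indices by one, since the forward difference of a
Charlier polynomial is a multiple of its predecessor. The smaller index reaches \<open>0\<close> first.\<close>

lemma charlier_orthogonal:
  fixes \<mu> :: real
  shows "poisson_functional \<mu> (charlier \<mu> m * charlier \<mu> n) = (if m = n then fact n * \<mu> ^ n else 0)"
proof (induction m arbitrary: n)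
  case 0
  have zero: "poisson_functional \<mu> 0 = 0"
    by (simp add: poisson_functional_def)
  show ?case
  proof (cases n)
    case 0
    then show ?thesis
      using poisson_weight_sums[of \<mu>] by (simp add: poisson_functional_def sums_iff)
  next
    case (Suc k)
    then show ?thesis
      using charlier_adjoint[of \<mu> k 1] zero by (simp add: pcompose_1)
  qed
next
  case (Suc m)
  have "charlier \<mu> n \<circ>\<^sub>p [:1, 1:] - charlier \<mu> n = smult (of_nat n) (charlier \<mu> (n - 1))"
    unfolding poly_eq_poly_eq_iff[symmetric]
    using charlier_forward_difference[of \<mu> n] by (auto simp: poly_pcompose add.commute)
  then have "poisson_functional \<mu> (charlier \<mu> (Suc m) * charlier \<mu> n) =
      \<mu> * poisson_functional \<mu> (smult (of_nat n) (charlier \<mu> m * charlier \<mu> (n - 1)))"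
    by (simp only: charlier_adjoint mult_smult_right)
  also have "\<dots> = \<mu> * (of_nat n * poisson_functional \<mu> (charlier \<mu> m * charlier \<mu> (n - 1)))"
    using poisson_functional_linear[of \<mu> "of_nat n" "charlier \<mu> m * charlier \<mu> (n - 1)" 0 0] by simp
  also have "\<dots> = (if Suc m = n then fact n * \<mu> ^ n else 0)"
    unfolding Suc.IH by (cases n) auto
  finally show ?case .
qed

section \<open>The kernel formula for the Sobolev type polynomials\<close>

lemma monic_basis_expansion:
  fixes P :: "nat \<Rightarrow> real poly"
  assumes "\<And>k. degree (P k) = k \<and> lead_coeff (P k) = 1"
    and "\<And>k. n \<le> k \<Longrightarrow> coeff q k = 0"
  shows "\<exists>a. q = (\<Sum>k<n. smult (a k) (P k))"
  using assms(2)
proof (induction n arbitrary: q)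
  case 0
  then show ?case by (auto intro: poly_eqI)
next
  case (Suc n)
  define q' where "q' = q - smult (coeff q n) (P n)"
  have "coeff q' k = 0" if "n \<le> k" for k
    using assms(1)[of n] Suc.prems[of k] that
    by (cases "k = n") (auto simp: q'_def coeff_eq_0)
  then obtain a where a: "q' = (\<Sum>k<n. smult (a k) (P k))"
    using Suc.IH by blast
  have "q = (\<Sum>k<Suc n. smult ((a(n := coeff q n)) k) (P k))"
    using a by (simp add: q'_def algebra_simps)
  then show ?case by blast
qed

lemma linear_sum:
  fixes L :: "real poly \<Rightarrow> real"
  assumes "\<And>a f b g. L (smult a f + smult b g) = a * L f + b * L g"
  shows "L (\<Sum>k\<in>I. smult (a k) (P k)) = (\<Sum>k\<in>I. a k * L (P k))"
proof (induction I rule: infinite_finite_induct)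
  case (insert x I)
  then show ?case using assms[of "a x" "P x" 1 "\<Sum>k\<in>I. smult (a k) (P k)"] by simp
qed (use assms[of 0 0 0 0] in simp_all)

lemma charlier_sobolev_inner_eq:
  "charlier_sobolev_inner \<mu> \<alpha> lam j f g = poisson_functional \<mu> (f * g)
     + lam * (fwd_diff ^^ j) (poly f) \<alpha> * (fwd_diff ^^ j) (poly g) \<alpha>"
  by (simp add: charlier_sobolev_inner_def poisson_functional_def poisson_weight_def)

lemma charlier_sobolev_inner_linear:
  "charlier_sobolev_inner \<mu> \<alpha> lam j f (smult a g + smult b h) =
    a * charlier_sobolev_inner \<mu> \<alpha> lam j f g + b * charlier_sobolev_inner \<mu> \<alpha> lam j f h"
proof -
  have "f * (smult a g + smult b h) = smult a (f * g) + smult b (f * h)"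
    by (simp add: algebra_simps)
  then show ?thesis
    unfolding charlier_sobolev_inner_eq
    by (simp only: poisson_functional_linear fwd_diff_iter_poly_linear) (simp add: algebra_simps)
qed

text \<open>The coefficients of a polynomial in the Charlier basis are its moments against that basis, divided by
nonzero norms.\<close>

lemma charlier_determined_by_moments:
  fixes \<mu> :: real
  assumes "\<mu> > 0" and low: "\<And>k. n \<le> k \<Longrightarrow> coeff q k = 0"
    and orth: "\<And>k. k < n \<Longrightarrow> poisson_functional \<mu> (charlier \<mu> k * q) = 0"
  shows "q = 0"
proof -
  obtain a where a: "q = (\<Sum>k<n. smult (a k) (charlier \<mu> k))"
    using monic_basis_expansion[of "charlier \<mu>" n q] charlier_monic low by blast
  have "a i = 0" if "i < n" for i
  proof -
    have "0 = poisson_functional \<mu> (\<Sum>k<n. smult (a k) (charlier \<mu> i * charlier \<mu> k))"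
      using orth[OF that] by (simp add: a sum_distrib_left)
    also have "\<dots> = (\<Sum>k<n. a k * poisson_functional \<mu> (charlier \<mu> i * charlier \<mu> k))"
      by (rule linear_sum) (rule poisson_functional_linear)
    also have "\<dots> = a i * (fact i * \<mu> ^ i)"
      using that by (simp add: charlier_orthogonal if_distrib[of "\<lambda>u. _ * u"] sum.delta cong: if_cong)
    finally show ?thesis using \<open>\<mu> > 0\<close> by simp
  qed
  then show ?thesis by (simp add: a)
qed

definition charlier_diff :: "real \<Rightarrow> real \<Rightarrow> nat \<Rightarrow> nat \<Rightarrow> real" where
  "charlier_diff \<mu> \<alpha> j k = (fwd_diff ^^ j) (poly (charlier \<mu> k)) \<alpha>"

definition kernel_poly :: "real \<Rightarrow> real \<Rightarrow> nat \<Rightarrow> nat \<Rightarrow> real poly" where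
  "kernel_poly \<mu> \<alpha> j n = (\<Sum>k<n. smult (charlier_diff \<mu> \<alpha> j k / (fact k * \<mu> ^ k)) (charlier \<mu> k))"

definition kernel_diag :: "real \<Rightarrow> real \<Rightarrow> nat \<Rightarrow> nat \<Rightarrow> real" where
  "kernel_diag \<mu> \<alpha> j n = (\<Sum>k<n. (charlier_diff \<mu> \<alpha> j k)\<^sup>2 / (fact k * \<mu> ^ k))"

text \<open>Orthogonality to all polynomials of lower degree fixes the Poisson moments of \<open>S n\<close>
against the Charlier polynomials of lower degree up to the single number \<open>s\<close>, its \<open>j\<close>-th difference at \<open>\<alpha>\<close>. The kernel
polynomial has moments \<open>\<Delta>\<^sup>j C\<^sub>k(\<alpha>)\<close>, so a multiple of it accounts for the whole
deviation from the Charlier polynomial. Taking the \<open>j\<close>-th difference at \<open>\<alpha>\<close> gives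
a linear equation for \<open>s\<close>.\<close>

lemma charlier_sobolev_kernel_formula:
  assumes "\<mu> > 0" "lam > 0" and S: "monic_orthogonal_seq (charlier_sobolev_inner \<mu> \<alpha> lam j) S"
  shows "S n = charlier \<mu> n
    - smult (charlier_diff \<mu> \<alpha> j n / (1 / lam + kernel_diag \<mu> \<alpha> j n)) (kernel_poly \<mu> \<alpha> j n)"
proof -
  define D where "D p = (fwd_diff ^^ j) (poly p) \<alpha>" for p
  define s where "s = D (S n)"
  define Q where "Q = S n - charlier \<mu> n + smult (lam * s) (kernel_poly \<mu> \<alpha> j n)"
  have monic: "degree (S k) = k \<and> lead_coeff (S k) = 1" for k
    using S[unfolded monic_orthogonal_seq_def, THEN conjunct1] by blast
  have D_linear: "D (smult a p + smult b q) = a * D p + b * D q" for a b p q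
    unfolding D_def by (rule fwd_diff_iter_poly_linear)
  have S_orth: "poisson_functional \<mu> (charlier \<mu> m * S n) = - lam * s * charlier_diff \<mu> \<alpha> j m" if "m < n" for m
  proof -
    have "coeff (charlier \<mu> m) k = 0" if "n \<le> k" for k
      using \<open>m < n\<close> that by (intro coeff_eq_0) (simp add: degree_charlier)
    then obtain a where a: "charlier \<mu> m = (\<Sum>k<n. smult (a k) (S k))"
      using monic_basis_expansion[of S n "charlier \<mu> m", OF monic] by blast
    have "charlier_sobolev_inner \<mu> \<alpha> lam j (S n) (charlier \<mu> m) =
        (\<Sum>k<n. a k * charlier_sobolev_inner \<mu> \<alpha> lam j (S n) (S k))"
      unfolding a by (rule linear_sum) (rule charlier_sobolev_inner_linear)
    also have "\<dots> = 0"
      using S by (intro sum.neutral) (auto simp: monic_orthogonal_seq_def)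
    finally show ?thesis
      by (simp add: charlier_sobolev_inner_eq s_def D_def charlier_diff_def mult.commute)
  qed
  have K_orth: "poisson_functional \<mu> (charlier \<mu> m * kernel_poly \<mu> \<alpha> j n) = charlier_diff \<mu> \<alpha> j m" if "m < n" for m
  proof -
    have "poisson_functional \<mu> (charlier \<mu> m * kernel_poly \<mu> \<alpha> j n) =
        (\<Sum>k<n. charlier_diff \<mu> \<alpha> j k / (fact k * \<mu> ^ k) * poisson_functional \<mu> (charlier \<mu> m * charlier \<mu> k))"
      unfolding kernel_poly_def sum_distrib_left mult_smult_right
      by (rule linear_sum) (rule poisson_functional_linear)
    also have "\<dots> = charlier_diff \<mu> \<alpha> j m"
      using that \<open>\<mu> > 0\<close> by (simp add: charlier_orthogonal if_distrib[of "\<lambda>u. _ * u"] sum.delta cong: if_cong)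
    finally show ?thesis .
  qed
  have "Q = 0"
  proof (rule charlier_determined_by_moments[OF \<open>\<mu> > 0\<close>])
    fix k assume "n \<le> k"
    have "coeff (kernel_poly \<mu> \<alpha> j n) k = 0"
      using \<open>n \<le> k\<close> by (auto simp: kernel_poly_def coeff_sum degree_charlier intro!: sum.neutral coeff_eq_0)
    moreover have "coeff (S n) k = coeff (charlier \<mu> n) k"
    proof (cases "k = n")
      case True
      then show ?thesis
        using monic[of n] charlier_monic[of \<mu> n] by metis
    next
      case False
      then have "n < k" using \<open>n \<le> k\<close> by simp
      then show ?thesis
        using monic[of n] by (simp add: coeff_eq_0 degree_charlier)
    qed
    ultimately show "coeff Q k = 0" by (simp add: Q_def)
  next
    fix k assume "k < n"
    have "charlier \<mu> k * Q = smult 1 (smult 1 (charlier \<mu> k * S n) + smult (- 1) (charlier \<mu> k * charlier \<mu> n))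
        + smult (lam * s) (charlier \<mu> k * kernel_poly \<mu> \<alpha> j n)"
      by (simp add: Q_def algebra_simps)
    then show "poisson_functional \<mu> (charlier \<mu> k * Q) = 0"
      using \<open>k < n\<close> by (simp only: poisson_functional_linear S_orth K_orth charlier_orthogonal) simp
  qed
  then have eq: "S n = charlier \<mu> n - smult (lam * s) (kernel_poly \<mu> \<alpha> j n)"
    by (simp add: Q_def algebra_simps)
  have "D (kernel_poly \<mu> \<alpha> j n) = kernel_diag \<mu> \<alpha> j n"
    unfolding kernel_poly_def linear_sum[of D, OF D_linear]
    by (simp add: kernel_diag_def D_def charlier_diff_def power2_eq_square)
  moreover have "smult 1 (charlier \<mu> n) + smult (- (lam * s)) (kernel_poly \<mu> \<alpha> j n) = S n"
    using eq by simp
  ultimately have "s = charlier_diff \<mu> \<alpha> j n - lam * s * kernel_diag \<mu> \<alpha> j n"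
    using D_linear[of 1 "charlier \<mu> n" "- (lam * s)" "kernel_poly \<mu> \<alpha> j n"]
    by (simp add: s_def[symmetric]) (simp add: D_def charlier_diff_def)
  moreover have "kernel_diag \<mu> \<alpha> j n \<ge> 0"
    using \<open>\<mu> > 0\<close> by (auto simp: kernel_diag_def intro!: sum_nonneg)
  then have "1 / lam + kernel_diag \<mu> \<alpha> j n > 0"
    using \<open>lam > 0\<close> by (simp add: add_pos_nonneg)
  ultimately have "lam * s = charlier_diff \<mu> \<alpha> j n / (1 / lam + kernel_diag \<mu> \<alpha> j n)"
    using \<open>lam > 0\<close> by (simp add: eq_divide_eq) (simp add: algebra_simps)
  then show ?thesis using eq by simp
qed

section \<open>Tools for uniform limits\<close>

lemma uniform_limit_of_tendsto:
  "(f \<longlongrightarrow> c) F \<Longrightarrow> uniform_limit K (\<lambda>n z. f n) (\<lambda>_. c) F"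
  by (auto intro!: uniform_limitI dest: tendstoD elim: eventually_mono)

lemma uniform_limit_ratio_one:
  fixes a b :: complex
  assumes "bounded K"
  shows "uniform_limit K (\<lambda>n z. (of_nat n + a) / (of_nat n + b - z)) (\<lambda>_. 1) sequentially"
proof -
  obtain R where R: "norm z \<le> R" if "z \<in> K" for z
    using assms by (auto simp: bounded_iff)
  define C where "C = norm a + norm b + R"
  have "uniform_limit K (\<lambda>n z. (of_nat n + a) / (of_nat n + b - z) - 1) (\<lambda>_. 0) sequentially"
  proof (rule uniform_limit_null_comparison)
    have "\<forall>\<^sub>F n in sequentially. real n > norm b + \<bar>R\<bar>"
      by real_asymp
    then show "\<forall>\<^sub>F n in sequentially. \<forall>z\<in>K.
        norm ((of_nat n + a) / (of_nat n + b - z) - 1) \<le> C / (real n - (norm b + \<bar>R\<bar>))"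
    proof eventually_elim
      case (elim n)
      show ?case
      proof
        fix z assume "z \<in> K"
        have "norm (of_nat n :: complex) \<le> norm (of_nat n + b - z) + norm (z - b)"
          using norm_triangle_ineq[of "of_nat n + b - z" "z - b"] by simp
        moreover have "norm (z - b) \<le> norm b + R"
          using norm_triangle_ineq4[of z b] R[OF \<open>z \<in> K\<close>] by linarith
        ultimately have den: "norm (of_nat n + b - z) \<ge> real n - (norm b + \<bar>R\<bar>)"
          by simp
        have "(of_nat n + a) / (of_nat n + b - z) - 1 = (a - b + z) / (of_nat n + b - z)"
          using den elim by (cases "of_nat n + b - z = 0") (auto simp: divide_simps)
        moreover have "norm (a - b + z) \<le> C"
          using norm_triangle_ineq4[of a b] norm_triangle_ineq[of "a - b" z] R[OF \<open>z \<in> K\<close>]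
          by (simp add: C_def)
        ultimately show "norm ((of_nat n + a) / (of_nat n + b - z) - 1) \<le> C / (real n - (norm b + \<bar>R\<bar>))"
          using den elim by (auto simp: norm_divide intro!: frac_le order.trans[OF norm_ge_zero])
      qed
    qed
    show "uniform_limit K (\<lambda>n z. C / (real n - (norm b + \<bar>R\<bar>))) (\<lambda>_. 0) sequentially"
      by (rule uniform_limit_of_tendsto) real_asymp
  qed
  from uniform_limit_add[OF this uniform_limit_const[where c = "\<lambda>_. 1"]] show ?thesis
    by simp
qed

text \<open>Since \<open>n \<rho>\<^sub>n\<close> converges, \<open>\<rho>\<^sub>n\<close> tends to \<open>0\<close> and \<open>x\<close> is bounded by comparison with a geometric
recurrence, so the perturbation \<open>\<rho>\<^sub>n x\<^sub>n\<close> vanishes in the limit, and multiplying it by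
\<open>n\<close> exhibits the first-order correction \<open>r l / n\<close>. Kernel sums that are dominated by
their last term satisfy such recurrences after division by that term. The factor \<open>n + 2\<close>
in the hypothesis anticipates the index shift in the second conclusion.\<close>

lemma uniform_limit_perturbed_recurrence:
  fixes x :: "nat \<Rightarrow> 'b \<Rightarrow> 'a::real_normed_field"
  assumes rec: "\<And>n z. N \<le> n \<Longrightarrow> z \<in> K \<Longrightarrow> x (Suc n) z = a (Suc n) z + \<rho> n z * x n z"
    and a: "uniform_limit K a l sequentially" and l: "bounded (l ` K)"
    and \<rho>: "uniform_limit K (\<lambda>n z. of_nat (n + 2) * \<rho> n z) (\<lambda>_. r) sequentially"
    and x: "\<And>n. bounded (x n ` K)"
  shows "uniform_limit K x l sequentially"
    and "uniform_limit K (\<lambda>n z. of_nat (n + 1) * (x n z - a n z)) (\<lambda>z. r * l z) sequentially"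
proof -
  have rec_eventually: "\<forall>\<^sub>F n in sequentially. \<forall>z\<in>K. x (Suc n) z = a (Suc n) z + \<rho> n z * x n z"
    using eventually_ge_at_top[of N] by eventually_elim (simp add: rec)
  have "(\<lambda>n. inverse (real (n + 2))) \<longlonglongrightarrow> 0"
    by real_asymp
  then have "(\<lambda>n. of_real (inverse (real (n + 2))) :: 'a) \<longlonglongrightarrow> of_real 0"
    by (rule tendsto_of_real)
  then have "uniform_limit K (\<lambda>n z. inverse (of_nat (n + 2)) * (of_nat (n + 2) * \<rho> n z)) (\<lambda>z. 0 * r) sequentially"
    by (intro uniform_lim_mult[OF uniform_limit_of_tendsto \<rho>]) (auto simp: image_constant_conv)
  then have \<rho>0: "uniform_limit K \<rho> (\<lambda>z. 0) sequentially"
    by (rule uniform_limit_cong'[THEN iffD1, rotated 2])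
       (simp_all only: mult.assoc[symmetric] of_nat_eq_0_iff left_inverse, simp_all)
  obtain L where L: "norm (l z) \<le> L" if "z \<in> K" for z
    using l by (auto simp: bounded_iff)
  have "\<forall>\<^sub>F n in sequentially. \<forall>z\<in>K. norm (\<rho> n z) \<le> 1 / 2"
    using uniform_limitD[OF \<rho>0, of "1 / 2"] by (auto elim!: eventually_mono intro: less_imp_le)
  moreover have "\<forall>\<^sub>F n in sequentially. \<forall>z\<in>K. norm (a n z) \<le> L + 1"
    using uniform_limitD[OF a, of 1, simplified]
  proof eventually_elim
    case (elim n)
    show ?case
    proof
      fix z assume "z \<in> K"
      then show "norm (a n z) \<le> L + 1"
        using elim L[of z] norm_triangle_ineq2[of "a n z" "l z"] by (fastforce simp: dist_norm)
    qed
  qed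
  moreover have "\<forall>\<^sub>F n in sequentially. N \<le> n"
    by (rule eventually_ge_at_top)
  ultimately have "\<forall>\<^sub>F n in sequentially. N \<le> n \<and> (\<forall>z\<in>K. norm (\<rho> n z) \<le> 1 / 2) \<and> (\<forall>z\<in>K. norm (a n z) \<le> L + 1)"
    by eventually_elim auto
  then obtain M where M: "N \<le> n \<and> (\<forall>z\<in>K. norm (\<rho> n z) \<le> 1 / 2) \<and> (\<forall>z\<in>K. norm (a n z) \<le> L + 1)" if "M \<le> n" for n
    by (auto simp: eventually_sequentially)
  obtain B where B: "norm (x M z) \<le> B" if "z \<in> K" for z
    using x[of M] by (auto simp: bounded_iff)
  define B' where "B' = max B (2 * (L + 1))"
  have x_bound: "norm (x n z) \<le> B'" if "M \<le> n" "z \<in> K" for n z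
    using that(1)
  proof (induction n rule: dec_induct)
    case base
    then show ?case using B[OF \<open>z \<in> K\<close>] by (simp add: B'_def)
  next
    case (step n)
    have "norm (x (Suc n) z) \<le> norm (a (Suc n) z) + norm (\<rho> n z) * norm (x n z)"
      using rec[of n z] M[of n] step.hyps \<open>z \<in> K\<close> by (metis norm_mult norm_triangle_ineq)
    also have "\<dots> \<le> (L + 1) + 1 / 2 * B'"
      using M[of n] M[of "Suc n"] step \<open>z \<in> K\<close> by (intro add_mono mult_mono) auto
    also have "\<dots> \<le> B'"
      unfolding B'_def by (auto simp: max_def)
    finally show ?case .
  qed
  have "uniform_limit K (\<lambda>n z. \<rho> n z * x n z) (\<lambda>z. 0) sequentially"
  proof (rule uniform_limit_null_comparison)
    show "\<forall>\<^sub>F n in sequentially. \<forall>z\<in>K. norm (\<rho> n z * x n z) \<le> norm (\<rho> n z) * B'"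
      using eventually_ge_at_top[of M] by eventually_elim (auto simp: norm_mult intro!: mult_left_mono x_bound)
    have "uniform_limit K (\<lambda>n z. norm (\<rho> n z) * B') (\<lambda>z. norm (0 :: 'a) * B') sequentially"
      by (intro uniform_lim_mult uniform_limit_norm \<rho>0 uniform_limit_const) (auto simp: image_constant_conv)
    then show "uniform_limit K (\<lambda>n z. norm (\<rho> n z) * B') (\<lambda>z. 0) sequentially" by simp
  qed
  moreover have "uniform_limit K (\<lambda>n. a (Suc n)) l sequentially"
    using a by (simp add: filterlim_sequentially_Suc)
  ultimately have "uniform_limit K (\<lambda>n z. a (Suc n) z + \<rho> n z * x n z) (\<lambda>z. l z + 0) sequentially"
    by (intro uniform_limit_add)
  then have "uniform_limit K (\<lambda>n. x (Suc n)) l sequentially"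
    by (rule uniform_limit_cong[THEN iffD1, rotated 2])
       (use rec_eventually in \<open>auto elim!: eventually_mono\<close>)
  then show x_lim: "uniform_limit K x l sequentially"
    by (simp add: filterlim_sequentially_Suc)
  have "uniform_limit K (\<lambda>n z. (of_nat (n + 2) * \<rho> n z) * x n z) (\<lambda>z. r * l z) sequentially"
    by (intro uniform_lim_mult \<rho> x_lim l) (auto simp: image_constant_conv)
  then have "uniform_limit K (\<lambda>n z. of_nat (Suc n + 1) * (x (Suc n) z - a (Suc n) z)) (\<lambda>z. r * l z) sequentially"
    by (rule uniform_limit_cong[THEN iffD1, rotated 2])
       (use rec_eventually in \<open>auto elim!: eventually_mono\<close>)
  then show "uniform_limit K (\<lambda>n z. of_nat (n + 1) * (x n z - a n z)) (\<lambda>z. r * l z) sequentially"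
    by (subst (asm) filterlim_sequentially_Suc)
qed

section \<open>Asymptotics of the Charlier polynomials\<close>

text \<open>The factor \<open>rGamma (n - z)\<close> compensates the growth of the polynomials; being entire, it
spares a case distinction at the nonnegative integers, where the limit vanishes.\<close>

definition scaled_charlier :: "real \<Rightarrow> nat \<Rightarrow> complex \<Rightarrow> complex" where
  "scaled_charlier \<mu> n z = (-1) ^ n * rGamma (of_nat n - z) * poly (charlier (complex_of_real \<mu>) n) z"

definition charlier_limit :: "real \<Rightarrow> complex \<Rightarrow> complex" where
  "charlier_limit \<mu> z = complex_of_real (exp \<mu>) * rGamma (- z)"

lemma rGamma_step: "rGamma (of_nat n - z) = (of_nat n - z) * rGamma (of_nat (Suc n) - z)" for z :: complex
  using rGamma_plus1[of "of_nat n - z"] by (simp add: algebra_simps)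

text \<open>The leading parts of the three-term recurrence cancel in the scaled difference. Both sides are
multiplied by the denominators, so that the identity holds for every \<open>z\<close>.\<close>

lemma scaled_charlier_difference:
  "(of_nat (Suc k) - z) * (of_nat k - z) * (scaled_charlier \<mu> (k + 2) z - scaled_charlier \<mu> (k + 1) z)
     = complex_of_real \<mu> * ((of_nat k - z) * scaled_charlier \<mu> (k + 1) z - of_nat (k + 1) * scaled_charlier \<mu> k z)"
proof -
  define C where "C i = poly (charlier (complex_of_real \<mu>) i) z" for i
  define g where "g = rGamma (of_nat (k + 2) - z)"
  have C: "C (k + 2) = (z - of_nat (k + 1) - of_real \<mu>) * C (k + 1) - of_nat (k + 1) * of_real \<mu> * C k"
    using poly_charlier_Suc[of "complex_of_real \<mu>" "Suc k" z] by (simp add: C_def del: charlier.simps)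
  have g1: "rGamma (of_nat (k + 1) - z) = (of_nat (k + 1) - z) * g"
    using rGamma_step[of "Suc k" z] by (simp add: g_def)
  have g0: "rGamma (of_nat k - z) = (of_nat k - z) * ((of_nat (k + 1) - z) * g)"
    using rGamma_step[of k z] g1 by simp
  show ?thesis
    unfolding scaled_charlier_def C_def[symmetric] g_def[symmetric] g1 g0 C
    by (simp add: algebra_simps)
qed

text \<open>This is the forward difference relation in scaled form. Once the increments are known to be
\<open>o(1/n)\<close> it becomes \<open>G(z + 1) = - (1 + z) G(z)\<close> in the limit, which is the
functional equation of \<open>1 / \<Gamma>(-z)\<close>.\<close>

lemma scaled_charlier_shift:
  "scaled_charlier \<mu> (Suc k) (z + 1) =
     of_nat (Suc k) * (scaled_charlier \<mu> (Suc k) z - scaled_charlier \<mu> k z) - (1 + z) * scaled_charlier \<mu> (Suc k) z"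
proof -
  define C where "C i = poly (charlier (complex_of_real \<mu>) i)" for i
  define g where "g = rGamma (of_nat (Suc k) - z)"
  have C: "C (Suc k) (z + 1) = C (Suc k) z + of_nat (Suc k) * C k z"
    using charlier_forward_difference[of "complex_of_real \<mu>" "Suc k" z]
    by (simp add: C_def algebra_simps del: charlier.simps)
  have g0: "rGamma (of_nat k - z) = (of_nat k - z) * g"
    unfolding g_def by (rule rGamma_step)
  have g0': "rGamma (of_nat (Suc k) - (z + 1)) = (of_nat k - z) * g"
    using g0 by simp
  show ?thesis
    unfolding scaled_charlier_def C_def[symmetric] g_def[symmetric] g0 g0' C
    by (simp add: algebra_simps)
qed

lemma continuous_on_rGamma_minus: "continuous_on K (\<lambda>z :: complex. rGamma (c - z))"
  by (intro continuous_on_compose2[OF continuous_on_rGamma[of UNIV]] continuous_intros) auto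

lemma bounded_charlier_limit: "compact K \<Longrightarrow> bounded (charlier_limit \<mu> ` K)"
  unfolding charlier_limit_def using continuous_on_rGamma_minus[of K 0]
  by (intro compact_imp_bounded compact_continuous_image continuous_intros) auto

text \<open>By the difference identity, \<open>n\<close> times the increment is asymptotically \<open>\<mu>\<close> times the
difference of two quantities that have the same limit.\<close>

lemma scaled_charlier_increment_null:
  assumes "compact K" and lim: "uniform_limit K (scaled_charlier \<mu>) (charlier_limit \<mu>) sequentially"
  shows "uniform_limit K (\<lambda>n z. of_nat (Suc n) * (scaled_charlier \<mu> (Suc n) z - scaled_charlier \<mu> n z))
     (\<lambda>z. 0) sequentially"
proof -
  note bounded = compact_imp_bounded[OF \<open>compact K\<close>] bounded_charlier_limit[OF \<open>compact K\<close>]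
  have lim1: "uniform_limit K (\<lambda>k. scaled_charlier \<mu> (Suc k)) (charlier_limit \<mu>) sequentially"
    using lim by (simp add: filterlim_sequentially_Suc)
  have "uniform_limit K (\<lambda>k z. (of_real \<mu> * ((of_nat k + 2) / (of_nat k + 1 - z))) *
      (scaled_charlier \<mu> (Suc k) z - (of_nat k + 1) / (of_nat k + 0 - z) * scaled_charlier \<mu> k z))
      (\<lambda>z. (of_real \<mu> * 1) * (charlier_limit \<mu> z - 1 * charlier_limit \<mu> z)) sequentially"
    by (intro uniform_lim_mult uniform_limit_minus uniform_limit_ratio_one lim lim1 uniform_limit_const bounded)
       (auto simp: image_constant_conv)
  moreover have "\<forall>\<^sub>F k in sequentially. \<forall>z\<in>K. norm z < real k"
  proof -
    obtain R where R: "norm z \<le> R" if "z \<in> K" for z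
      using bounded by (auto simp: bounded_iff)
    have "\<forall>\<^sub>F k in sequentially. R < real k" by real_asymp
    then show ?thesis by eventually_elim (use R in fastforce)
  qed
  then have "\<forall>\<^sub>F k in sequentially. \<forall>z\<in>K.
      (of_real \<mu> * ((of_nat k + 2) / (of_nat k + 1 - z))) *
        (scaled_charlier \<mu> (Suc k) z - (of_nat k + 1) / (of_nat k + 0 - z) * scaled_charlier \<mu> k z)
      = of_nat (Suc (Suc k)) * (scaled_charlier \<mu> (Suc (Suc k)) z - scaled_charlier \<mu> (Suc k) z)"
  proof eventually_elim
    case (elim k)
    show ?case
    proof
      fix z assume "z \<in> K"
      then have "norm z < real k" using elim by blast
      then have "z \<noteq> of_nat i" if "k \<le> i" for i
        using that by auto
      from this[of k] this[of "Suc k"] have nz: "of_nat k - z \<noteq> 0" "of_nat k + 1 - z \<noteq> 0"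
        by (auto simp: add.commute)
      show "(of_real \<mu> * ((of_nat k + 2) / (of_nat k + 1 - z))) *
        (scaled_charlier \<mu> (Suc k) z - (of_nat k + 1) / (of_nat k + 0 - z) * scaled_charlier \<mu> k z)
      = of_nat (Suc (Suc k)) * (scaled_charlier \<mu> (Suc (Suc k)) z - scaled_charlier \<mu> (Suc k) z)"
      proof -
        define d where "d = scaled_charlier \<mu> (Suc (Suc k)) z - scaled_charlier \<mu> (Suc k) z"
        define w where "w = (of_nat k - z) * scaled_charlier \<mu> (Suc k) z - of_nat (k + 1) * scaled_charlier \<mu> k z"
        have "(of_nat k + 1 - z) * (of_nat k - z) * d = of_real \<mu> * w"
          using scaled_charlier_difference[of k z \<mu>] by (simp add: d_def w_def algebra_simps)
        moreover have "scaled_charlier \<mu> (Suc k) z - (of_nat k + 1) / (of_nat k + 0 - z) * scaled_charlier \<mu> k z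
            = w / (of_nat k - z)"
          using nz by (simp add: w_def field_simps)
        moreover have "d = of_real \<mu> * w / ((of_nat k + 1 - z) * (of_nat k - z))"
          if "(of_nat k + 1 - z) * (of_nat k - z) * d = of_real \<mu> * w"
          using nz that[symmetric] by (simp only: nonzero_mult_div_cancel_left mult_eq_0_iff) simp
        ultimately show ?thesis
          unfolding d_def[symmetric] by simp
      qed
    qed
  qed
  ultimately have "uniform_limit K
      (\<lambda>k z. of_nat (Suc (Suc k)) * (scaled_charlier \<mu> (Suc (Suc k)) z - scaled_charlier \<mu> (Suc k) z))
      (\<lambda>z. (of_real \<mu> * 1) * (charlier_limit \<mu> z - 1 * charlier_limit \<mu> z)) sequentially"
    by (rule uniform_limit_cong[THEN iffD1, rotated 2]) auto
  then show ?thesis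
    by (subst filterlim_sequentially_Suc[symmetric]) simp
qed

text \<open>The quotient of the \<open>i\<close>-th term of the explicit sum for the scaled polynomial by \<open>\<mu>\<^sup>i / i! \<cdot> 1 / \<Gamma>(-z)\<close>. For
\<open>i > n\<close> the product contains the factor with \<open>l = n\<close>, which is zero; hence the
finite sum may be written as an infinite series.\<close>

definition falling_ratio :: "nat \<Rightarrow> nat \<Rightarrow> complex \<Rightarrow> complex" where
  "falling_ratio i n z = (\<Prod>l<i. of_nat (n - l) / (of_nat (n - l) - 1 - z))"

lemma falling_ratio_pochhammer:
  assumes "Re z \<le> - 1" "i \<le> n"
  shows "fact n / fact (n - i) * pochhammer (- z) (n - i) * rGamma (of_nat n - z)
     = rGamma (- z) * falling_ratio i n z"
  using assms(2)
proof (induction i)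
  case 0
  then show ?case
    using pochhammer_rGamma[of "- z" n] by (simp add: falling_ratio_def)
next
  case (Suc i)
  obtain k where k: "n - i = Suc k"
    using Suc.prems by (metis Suc_diff_Suc Suc_le_lessD)
  have "Re (of_nat k - z) > 0"
    using assms(1) by simp
  then have nz: "of_nat k - z \<noteq> 0"
    by (metis less_irrefl zero_complex.sel(1))
  have k': "n - Suc i = k" using k by simp
  have IH: "fact n / fact (Suc k) * (pochhammer (- z) k * (of_nat k - z)) * rGamma (of_nat n - z)
      = rGamma (- z) * falling_ratio i n z"
    using Suc k by (simp add: pochhammer_Suc)
  have "falling_ratio (Suc i) n z = falling_ratio i n z * (of_nat (Suc k) / (of_nat k - z))"
    by (simp add: falling_ratio_def k)
  then have "rGamma (- z) * falling_ratio (Suc i) n z =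
      fact n / fact (Suc k) * (pochhammer (- z) k * (of_nat k - z)) * rGamma (of_nat n - z) * (of_nat (Suc k) / (of_nat k - z))"
    using IH by simp
  also have "\<dots> = fact n / fact k * pochhammer (- z) k * rGamma (of_nat n - z)"
    using nz by (simp add: field_simps del: of_nat_Suc)
  finally show ?case
    using k' by simp
qed

text \<open>In this half-plane every denominator is at least as large as its numerator, which provides the
domination needed to pass to the limit term by term.\<close>

lemma norm_falling_ratio_le: "Re z \<le> - 1 \<Longrightarrow> norm (falling_ratio i n z) \<le> 1"
  unfolding falling_ratio_def prod_norm[symmetric]
proof (rule prod_le_1)
  fix l assume "Re z \<le> - 1"
  have "real (n - l) \<le> Re (of_nat (n - l) - 1 - z)"
    using \<open>Re z \<le> - 1\<close> by simp
  also have "\<dots> \<le> norm (of_nat (n - l) - 1 - z)"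
    by (rule complex_Re_le_cmod)
  finally show "0 \<le> norm (of_nat (n - l) / (of_nat (n - l) - 1 - z)) \<and>
      norm (of_nat (n - l) / (of_nat (n - l) - 1 - z)) \<le> 1"
    by (cases "of_nat (n - l) - 1 - z = 0") (simp_all add: norm_divide)
qed

lemma scaled_charlier_series:
  assumes "Re z \<le> - 1"
  shows "scaled_charlier \<mu> n z = rGamma (- z) * (\<Sum>i. complex_of_real (\<mu> ^ i / fact i) * falling_ratio i n z)"
proof -
  have "falling_ratio i n z = 0" if "i > n" for i
    using that by (auto simp: falling_ratio_def intro!: bexI[of _ n])
  then have "(\<Sum>i. complex_of_real (\<mu> ^ i / fact i) * falling_ratio i n z) =
      (\<Sum>i\<le>n. complex_of_real (\<mu> ^ i / fact i) * falling_ratio i n z)"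
    by (intro suminf_finite) auto
  then have "rGamma (- z) * (\<Sum>i. complex_of_real (\<mu> ^ i / fact i) * falling_ratio i n z) =
      (\<Sum>i\<le>n. complex_of_real (\<mu> ^ i / fact i) * (rGamma (- z) * falling_ratio i n z))"
    by (simp add: sum_distrib_left mult_ac)
  also have "\<dots> = (\<Sum>i\<le>n. rGamma (of_nat n - z) * (of_nat (n choose i) * of_real \<mu> ^ i * pochhammer (- z) (n - i)))"
    by (intro sum.cong refl)
       (simp add: falling_ratio_pochhammer[OF assms, symmetric] binomial_fact)
  also have "\<dots> = scaled_charlier \<mu> n z"
    unfolding scaled_charlier_def charlier_explicit sum_distrib_left[symmetric]
    by (simp flip: mult.assoc power_mult_distrib)
  finally show ?thesis by simp
qed

text \<open>Uniform convergence on \<open>K\<close> to a constant is ordinary convergence along the product of the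
index filter with the principal filter of \<open>K\<close>; this turns Tannery's theorem into a statement
about uniform limits.\<close>

lemma eventually_prod_principal:
  "eventually P (F \<times>\<^sub>F principal K) \<longleftrightarrow> (\<forall>\<^sub>F x in F. \<forall>y\<in>K. P (x, y))"
proof
  assume "\<forall>\<^sub>F x in F. \<forall>y\<in>K. P (x, y)"
  then show "eventually P (F \<times>\<^sub>F principal K)"
    unfolding eventually_prod_filter eventually_principal
    by (intro exI[of _ "\<lambda>x. \<forall>y\<in>K. P (x, y)"] exI[of _ "\<lambda>y. y \<in> K"]) auto
qed (auto simp: eventually_prod_filter eventually_principal elim: eventually_mono)

lemma uniform_limit_iff_prod_filter:
  "uniform_limit K f (\<lambda>_. c) F \<longleftrightarrow> ((\<lambda>(n, z). f n z) \<longlongrightarrow> c) (F \<times>\<^sub>F principal K)"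
  by (simp add: uniform_limit_iff tendsto_iff case_prod_unfold eventually_prod_principal)

lemma falling_ratio_tendsto:
  assumes "bounded K"
  shows "uniform_limit K (\<lambda>n z. falling_ratio i n z) (\<lambda>_. 1) sequentially"
proof (induction i)
  case 0
  then show ?case by (simp add: falling_ratio_def uniform_limit_const)
next
  case (Suc i)
  have "uniform_limit K (\<lambda>n z. of_nat (n - i) / (of_nat (n - i) - 1 - z)) (\<lambda>_. 1) sequentially"
    using filterlim_compose[OF uniform_limit_ratio_one[OF assms, of 0 "- 1"]
        filterlim_minus_const_nat_at_top[of i]] by simp
  from uniform_lim_mult[OF Suc this] show ?case
    by (simp add: falling_ratio_def image_constant_conv)
qed

text \<open>Each term of the series tends to \<open>\<mu>\<^sup>i / i!\<close>, uniformly on \<open>K\<close>, and is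
bounded by \<open>\<bar>\<mu>\<bar>\<^sup>i / i!\<close>; Tannery's theorem sums the limits to \<open>exp \<mu>\<close>.\<close>

lemma scaled_charlier_limit_left:
  assumes "compact K" and left: "\<And>z. z \<in> K \<Longrightarrow> Re z \<le> - 1"
  shows "uniform_limit K (scaled_charlier \<mu>) (charlier_limit \<mu>) sequentially"
proof (cases "K = {}")
  case False
  define F where "F = (sequentially \<times>\<^sub>F principal K :: (nat \<times> complex) filter)"
  define a where "a i = (\<lambda>(n, z). complex_of_real (\<mu> ^ i / fact i) * falling_ratio i n z)" for i
  have "F \<noteq> bot"
    using False by (simp add: F_def prod_filter_eq_bot principal_eq_bot_iff)
  have "(a i \<longlongrightarrow> complex_of_real (\<mu> ^ i / fact i) * 1) F" for i
    using falling_ratio_tendsto[OF compact_imp_bounded[OF \<open>compact K\<close>], of i]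
    unfolding uniform_limit_iff_prod_filter F_def[symmetric] a_def case_prod_unfold
    by (intro tendsto_mult tendsto_const)
  moreover have "\<forall>\<^sub>F (i, nz) in at_top \<times>\<^sub>F F. norm (a i nz) \<le> \<bar>\<mu>\<bar> ^ i / fact i"
  proof -
    have "\<forall>\<^sub>F nz in F. snd nz \<in> K"
      unfolding F_def by (simp add: eventually_prod_principal)
    then have "\<forall>\<^sub>F nz in F. \<forall>i. norm (a i nz) \<le> \<bar>\<mu>\<bar> ^ i / fact i"
    proof eventually_elim
      case (elim nz)
      show ?case
        using norm_falling_ratio_le[OF left[OF elim]]
        by (auto simp: a_def case_prod_unfold norm_mult norm_divide norm_power mult_left_le divide_right_mono)
    qed
    then have "\<forall>\<^sub>F p in at_top \<times>\<^sub>F F. \<forall>i. norm (a i (snd p)) \<le> \<bar>\<mu>\<bar> ^ i / fact i"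
      by (rule eventually_compose_filterlim[OF _ filterlim_snd])
    then show ?thesis
      by eventually_elim auto
  qed
  moreover have "summable (\<lambda>i. \<bar>\<mu>\<bar> ^ i / fact i)"
    using summable_exp[of "\<bar>\<mu>\<bar>"] by (simp add: field_simps)
  ultimately have "((\<lambda>nz. \<Sum>i. a i nz) \<longlongrightarrow> (\<Sum>i. complex_of_real (\<mu> ^ i / fact i) * 1)) F"
    using tannerys_theorem[of a "\<lambda>i. complex_of_real (\<mu> ^ i / fact i) * 1" F "\<lambda>i. \<bar>\<mu>\<bar> ^ i / fact i"] \<open>F \<noteq> bot\<close>
    by blast
  moreover have "(\<Sum>i. complex_of_real (\<mu> ^ i / fact i) * 1) = complex_of_real (exp \<mu>)"
    using exp_converges[of "complex_of_real \<mu>"]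
    by (simp add: sums_iff scaleR_conv_of_real divide_inverse mult.commute exp_of_real)
  ultimately have lim: "uniform_limit K (\<lambda>n z. \<Sum>i. complex_of_real (\<mu> ^ i / fact i) * falling_ratio i n z)
      (\<lambda>_. complex_of_real (exp \<mu>)) sequentially"
    by (simp add: uniform_limit_iff_prod_filter F_def a_def case_prod_unfold)
  have "bounded ((\<lambda>z. rGamma (- z)) ` K)"
    using \<open>compact K\<close> continuous_on_rGamma_minus[of K 0]
    by (intro compact_imp_bounded compact_continuous_image) auto
  then have "uniform_limit K (\<lambda>n z. rGamma (- z) * (\<Sum>i. complex_of_real (\<mu> ^ i / fact i) * falling_ratio i n z))
      (\<lambda>z. rGamma (- z) * complex_of_real (exp \<mu>)) sequentially"
    by (intro uniform_lim_mult lim uniform_limit_const) (auto simp: image_constant_conv)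
  then show ?thesis
    by (rule uniform_limit_cong'[THEN iffD1, rotated 2])
       (auto simp: charlier_limit_def scaled_charlier_series left)
qed simp

text \<open>
Translating a compact set to the left by integers brings it into the half-plane of the previous lemma;
the shift relation carries the convergence back, one unit at a time.\<close>

lemma scaled_charlier_limit:
  assumes "compact K"
  shows "uniform_limit K (scaled_charlier \<mu>) (charlier_limit \<mu>) sequentially"
proof -
  have "uniform_limit K (scaled_charlier \<mu>) (charlier_limit \<mu>) sequentially"
    if "compact K" "\<forall>z\<in>K. Re z \<le> real m - 1" for m K
    using that
  proof (induction m arbitrary: K)
    case 0
    then show ?case by (intro scaled_charlier_limit_left) auto
  next
    case (Suc m)
    define J where "J = (\<lambda>z. z - 1) ` K"
    have "compact J"
      unfolding J_def using Suc.prems by (intro compact_continuous_image continuous_intros)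
    have lim: "uniform_limit J (scaled_charlier \<mu>) (charlier_limit \<mu>) sequentially"
      using Suc.prems by (intro Suc.IH \<open>compact J\<close>) (auto simp: J_def)
    have lim1: "uniform_limit J (\<lambda>n. scaled_charlier \<mu> (Suc n)) (charlier_limit \<mu>) sequentially"
      using lim by (simp add: filterlim_sequentially_Suc)
    have "uniform_limit J (\<lambda>n z. of_nat (Suc n) * (scaled_charlier \<mu> (Suc n) z - scaled_charlier \<mu> n z)
        - (1 + z) * scaled_charlier \<mu> (Suc n) z) (\<lambda>z. 0 - (1 + z) * charlier_limit \<mu> z) sequentially"
      using \<open>compact J\<close>
      by (intro uniform_limit_minus scaled_charlier_increment_null lim lim1 uniform_lim_mult uniform_limit_const
           bounded_charlier_limit compact_imp_bounded compact_continuous_image continuous_intros)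
    moreover have "0 - (1 + z) * charlier_limit \<mu> z = charlier_limit \<mu> (z + 1)" for z
    proof -
      have "rGamma (- (z + 1)) = - (1 + z) * rGamma (- z)"
        using rGamma_plus1[of "- (z + 1)"] by (simp add: algebra_simps)
      then show ?thesis by (simp only: charlier_limit_def) (simp add: algebra_simps)
    qed
    ultimately have "uniform_limit J (\<lambda>n z. scaled_charlier \<mu> (Suc n) (z + 1)) (\<lambda>z. charlier_limit \<mu> (z + 1)) sequentially"
      unfolding scaled_charlier_shift by simp
    then have "uniform_limit K (\<lambda>n z. scaled_charlier \<mu> (Suc n) z) (charlier_limit \<mu>) sequentially"
      by (simp add: uniform_limit_iff J_def)
    then show ?case
      by (simp add: filterlim_sequentially_Suc)
  qed
  moreover obtain R where R: "norm z \<le> R" if "z \<in> K" for z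
    using compact_imp_bounded[OF assms] by (auto simp: bounded_iff)
  obtain m :: nat where "R + 1 \<le> real m"
    using real_arch_simple by blast
  have "Re z \<le> real m - 1" if "z \<in> K" for z
    using R[OF that] complex_Re_le_cmod[of z] \<open>R + 1 \<le> real m\<close> by linarith
  ultimately show ?thesis
    using assms by blast
qed

section \<open>Ratios of consecutive differences at the negative point\<close>

lemma charlier_diff_shift:
  "charlier_diff \<mu> \<alpha> j (m + j) = fact (m + j) / fact m * poly (charlier \<mu> m) \<alpha>"
  unfolding charlier_diff_def by (rule fwd_diff_charlier)

lemma charlier_diff_nonzero:
  assumes "\<mu> > 0" "\<alpha> < 0" "j \<le> n"
  shows "charlier_diff \<mu> \<alpha> j n \<noteq> 0"
  using charlier_negative_argument[OF assms(1,2), of "n - j"] charlier_diff_shift[of \<mu> \<alpha> j "n - j"] assms(3)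
  by auto

lemma poly_charlier_of_real:
  "poly (charlier (complex_of_real \<mu>) n) (complex_of_real x) = complex_of_real (poly (charlier \<mu> n) x)"
proof -
  have "poly (map_poly complex_of_real p) (complex_of_real x) = complex_of_real (poly p x)" for p
    by (induction p) (simp_all add: map_poly_pCons)
  then show ?thesis
    by (simp flip: map_poly_charlier)
qed

text \<open>The error is a bounded multiple of \<open>n\<close> times the relative increment of the scaled polynomials at
\<open>\<alpha>\<close>, and their limit there is nonzero because \<open>- \<alpha>\<close> is not a pole of
\<open>\<Gamma>\<close>.\<close>

lemma charlier_ratio_asymptotics:
  assumes "\<mu> > 0" "\<alpha> < 0"
  shows "(\<lambda>m. - poly (charlier \<mu> (Suc m)) \<alpha> / poly (charlier \<mu> m) \<alpha> - (real m - \<alpha>)) \<longlonglongrightarrow> 0"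
proof -
  define z where "z = complex_of_real \<alpha>"
  define c where "c m = poly (charlier \<mu> m) \<alpha>" for m
  define A where "A m = scaled_charlier \<mu> m z" for m
  have lim: "uniform_limit {z} (scaled_charlier \<mu>) (charlier_limit \<mu>) sequentially"
    by (rule scaled_charlier_limit) simp
  then have A: "A \<longlonglongrightarrow> charlier_limit \<mu> z"
    by (simp add: A_def[abs_def])
  have incr: "(\<lambda>m. of_nat (Suc m) * (A (Suc m) - A m)) \<longlonglongrightarrow> 0"
    using scaled_charlier_increment_null[OF _ lim] by (simp add: A_def)
  have not_pole: "rGamma (of_nat m - z) \<noteq> 0" for m
  proof -
    have "of_nat m - z = complex_of_real (real m - \<alpha>)" by (simp add: z_def)
    moreover have "rGamma (real m - \<alpha>) \<noteq> 0"
      using \<open>\<alpha> < 0\<close> Gamma_real_pos[of "real m - \<alpha>"] by (auto simp: Gamma_def)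
    ultimately show ?thesis
      by (simp only: rGamma_complex_of_real of_real_eq_0_iff) simp
  qed
  have limit_nz: "charlier_limit \<mu> z \<noteq> 0"
    using not_pole[of 0] by (simp add: charlier_limit_def)
  have "(\<lambda>m. (real m - \<alpha>) / real (Suc m)) \<longlonglongrightarrow> 1"
    by real_asymp
  then have "(\<lambda>m. complex_of_real ((real m - \<alpha>) / real (Suc m))) \<longlonglongrightarrow> of_real 1"
    by (rule tendsto_of_real)
  from tendsto_divide[OF tendsto_mult[OF this incr] A limit_nz]
  have "(\<lambda>m. complex_of_real ((real m - \<alpha>) / real (Suc m)) * (of_nat (Suc m) * (A (Suc m) - A m)) / A m) \<longlonglongrightarrow> 0"
    by simp
  moreover have "complex_of_real ((real m - \<alpha>) / real (Suc m)) * (of_nat (Suc m) * (A (Suc m) - A m)) / A m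
      = complex_of_real (- c (Suc m) / c m - (real m - \<alpha>))" for m
  proof -
    define g where "g = rGamma (of_nat (Suc m) - z)"
    have g: "rGamma (of_nat m - z) = (of_nat m - z) * g"
      unfolding g_def by (rule rGamma_step)
    have nz: "g \<noteq> 0" "of_nat m - z \<noteq> 0"
      using not_pole[of m] g by auto
    have "c m \<noteq> 0"
      using charlier_negative_argument[OF assms, of m] by (auto simp: c_def)
    have A0: "A m = (-1) ^ m * ((of_nat m - z) * g) * of_real (c m)"
      and A1: "A (Suc m) = - ((-1) ^ m) * g * of_real (c (Suc m))"
      by (simp_all add: A_def scaled_charlier_def g z_def poly_charlier_of_real c_def g_def
          del: charlier.simps)
        (simp_all add: z_def[symmetric] g g_def)
    have "complex_of_real ((real m - \<alpha>) / real (Suc m)) * of_nat (Suc m) = of_nat m - z"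
      by (simp add: z_def del: of_nat_Suc)
    then have "complex_of_real ((real m - \<alpha>) / real (Suc m)) * (of_nat (Suc m) * (A (Suc m) - A m)) / A m
        = (of_nat m - z) * (A (Suc m) - A m) / A m"
      by (simp only: mult.assoc[symmetric])
    also have "\<dots> = - of_real (c (Suc m)) / of_real (c m) - (of_nat m - z)"
      unfolding A0 A1 using nz \<open>c m \<noteq> 0\<close> by (simp add: divide_simps) (simp add: algebra_simps)
    finally show ?thesis by (simp add: z_def)
  qed
  ultimately have "(\<lambda>m. complex_of_real (- c (Suc m) / c m - (real m - \<alpha>))) \<longlonglongrightarrow> of_real 0"
    by (simp only: of_real_0)
  then show ?thesis
    by (simp only: tendsto_of_real_iff c_def)
qed

definition diff_ratio :: "real \<Rightarrow> real \<Rightarrow> nat \<Rightarrow> nat \<Rightarrow> real" where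
  "diff_ratio \<mu> \<alpha> j n = - charlier_diff \<mu> \<alpha> j (Suc n) / charlier_diff \<mu> \<alpha> j n"

text \<open>The \<open>j\<close>-th difference lowers the index by \<open>j\<close>, which decreases the ratio by
\<open>j\<close>, and contributes the factor \<open>(n + 1) / (n + 1 - j)\<close>, which increases it by
\<open>j\<close> in the limit; the two effects cancel.\<close>

lemma diff_ratio_asymptotics:
  assumes "\<mu> > 0" "\<alpha> < 0"
  shows "(\<lambda>n. diff_ratio \<mu> \<alpha> j n - real n) \<longlonglongrightarrow> - \<alpha>"
proof (rule LIMSEQ_offset[where k = j])
  define q where "q m = - poly (charlier \<mu> (Suc m)) \<alpha> / poly (charlier \<mu> m) \<alpha>" for m
  have "diff_ratio \<mu> \<alpha> j (m + j) = real (m + j + 1) / real (m + 1) * q m" for m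
    unfolding diff_ratio_def q_def
    using charlier_diff_shift[of \<mu> \<alpha> j m] charlier_diff_shift[of \<mu> \<alpha> j "Suc m"]
    by (simp del: charlier.simps)
  moreover have "r * q - s = r * (q - t) + (r * t - s)" for r q s t :: real
    by (simp add: algebra_simps)
  ultimately have eq: "diff_ratio \<mu> \<alpha> j (m + j) - real (m + j) =
      real (m + j + 1) / real (m + 1) * (q m - (real m - \<alpha>))
      + (real (m + j + 1) / real (m + 1) * (real m - \<alpha>) - real (m + j))" for m
    by presburger
  have "(\<lambda>m. real (m + j + 1) / real (m + 1)) \<longlonglongrightarrow> 1"
    by real_asymp
  moreover have "(\<lambda>m. real (m + j + 1) / real (m + 1) * (real m - \<alpha>) - real (m + j)) \<longlonglongrightarrow> - \<alpha>"
    by real_asymp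
  ultimately have "(\<lambda>m. real (m + j + 1) / real (m + 1) * (q m - (real m - \<alpha>))
      + (real (m + j + 1) / real (m + 1) * (real m - \<alpha>) - real (m + j))) \<longlonglongrightarrow> 1 * 0 + - \<alpha>"
    using charlier_ratio_asymptotics[OF assms] unfolding q_def by (intro tendsto_add tendsto_mult)
  then show "(\<lambda>m. diff_ratio \<mu> \<alpha> j (m + j) - real (m + j)) \<longlonglongrightarrow> - \<alpha>"
    unfolding eq by simp
qed

lemma diff_ratio_inverse_asymptotics:
  assumes "\<mu> > 0" "\<alpha> < 0"
  shows "(\<lambda>n. real (n + 1) / diff_ratio \<mu> \<alpha> j n) \<longlonglongrightarrow> 1"
proof -
  have "(\<lambda>n. inverse (real (n + 1))) \<longlonglongrightarrow> 0" "(\<lambda>n. real n * inverse (real (n + 1))) \<longlonglongrightarrow> 1"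
    by real_asymp+
  then have "(\<lambda>n. (diff_ratio \<mu> \<alpha> j n - real n) * inverse (real (n + 1)) + real n * inverse (real (n + 1)))
      \<longlonglongrightarrow> - \<alpha> * 0 + 1"
    by (intro tendsto_add tendsto_mult diff_ratio_asymptotics assms)
  moreover have "(diff_ratio \<mu> \<alpha> j n - real n) * inverse (real (n + 1)) + real n * inverse (real (n + 1))
      = diff_ratio \<mu> \<alpha> j n / real (n + 1)" for n
    by (simp only: left_diff_distrib divide_inverse diff_add_cancel)
  ultimately have "(\<lambda>n. diff_ratio \<mu> \<alpha> j n / real (n + 1)) \<longlonglongrightarrow> 1"
    by simp
  from tendsto_inverse[OF this] show ?thesis
    by simp
qed

section \<open>Asymptotics of the kernel sums\<close>

definition kernel_fun :: "real \<Rightarrow> real \<Rightarrow> nat \<Rightarrow> nat \<Rightarrow> complex \<Rightarrow> complex" where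
  "kernel_fun \<mu> \<alpha> j n z = (\<Sum>k<n. of_real (charlier_diff \<mu> \<alpha> j k / (fact k * \<mu> ^ k))
     * poly (charlier (complex_of_real \<mu>) k) z)"

lemma poly_map_kernel:
  "poly (map_poly complex_of_real (charlier \<mu> n - smult c (kernel_poly \<mu> \<alpha> j n))) z
    = poly (charlier (complex_of_real \<mu>) n) z - of_real c * kernel_fun \<mu> \<alpha> j n z"
proof -
  have "map_poly complex_of_real (charlier \<mu> n - smult c (kernel_poly \<mu> \<alpha> j n)) =
      map_poly complex_of_real (charlier \<mu> n) - smult (of_real c)
        (\<Sum>k<n. smult (of_real (charlier_diff \<mu> \<alpha> j k / (fact k * \<mu> ^ k))) (map_poly complex_of_real (charlier \<mu> k)))"
    by (intro poly_eqI) (simp add: coeff_map_poly kernel_poly_def coeff_sum)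
  then show ?thesis
    by (simp add: map_poly_charlier kernel_fun_def poly_sum)
qed

text \<open>The kernel sum divided by the size of its last summand, so that a last summand alone would contribute
exactly the scaled Charlier polynomial.\<close>

definition scaled_kernel :: "real \<Rightarrow> real \<Rightarrow> nat \<Rightarrow> nat \<Rightarrow> complex \<Rightarrow> complex" where
  "scaled_kernel \<mu> \<alpha> j n z = (-1) ^ n * rGamma (of_nat n - z) * kernel_fun \<mu> \<alpha> j (Suc n) z
     * of_real (fact n * \<mu> ^ n / charlier_diff \<mu> \<alpha> j n)"

text \<open>Likewise for the denominator of the kernel formula, whose last summand is scaled to \<open>1\<close>.\<close>

definition scaled_diag :: "real \<Rightarrow> real \<Rightarrow> nat \<Rightarrow> real \<Rightarrow> nat \<Rightarrow> real" where
  "scaled_diag \<mu> \<alpha> j lam n = (1 / lam + kernel_diag \<mu> \<alpha> j (Suc n)) * (fact n * \<mu> ^ n)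
     / (charlier_diff \<mu> \<alpha> j n)\<^sup>2"

lemma scaled_kernel_Suc:
  assumes "\<mu> > 0" "\<alpha> < 0" "j \<le> n" "of_nat n \<noteq> z"
  shows "scaled_kernel \<mu> \<alpha> j (Suc n) z = scaled_charlier \<mu> (Suc n) z
    + of_real (real (n + 1) * \<mu> / diff_ratio \<mu> \<alpha> j n) / (of_nat n - z) * scaled_kernel \<mu> \<alpha> j n z"
proof -
  define b where "b = charlier_diff \<mu> \<alpha> j n"
  define b' where "b' = charlier_diff \<mu> \<alpha> j (Suc n)"
  define h where "h = fact n * \<mu> ^ n"
  define g where "g = rGamma (of_nat (Suc n) - z)"
  define K where "K = kernel_fun \<mu> \<alpha> j (Suc n) z"
  define C where "C = poly (charlier (complex_of_real \<mu>) (Suc n)) z"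
  have nz: "b \<noteq> 0" "b' \<noteq> 0" "h \<noteq> 0" "of_nat n - z \<noteq> 0"
    using assms charlier_diff_nonzero[OF assms(1,2)] by (simp_all add: b_def b'_def h_def)
  have g: "rGamma (of_nat n - z) = (of_nat n - z) * g"
    unfolding g_def by (rule rGamma_step)
  have h': "fact (Suc n) * \<mu> ^ Suc n = real (n + 1) * \<mu> * h"
    by (simp add: h_def)
  have K': "kernel_fun \<mu> \<alpha> j (Suc (Suc n)) z = K + of_real (b' / (real (n + 1) * \<mu> * h)) * C"
    unfolding K_def C_def kernel_fun_def b'_def h'[symmetric] by simp
  have "scaled_kernel \<mu> \<alpha> j (Suc n) z = - ((-1) ^ n) * g * (K + of_real (b' / (real (n + 1) * \<mu> * h)) * C)
      * of_real (real (n + 1) * \<mu> * h / b')"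
    unfolding scaled_kernel_def K' h' g_def b'_def by simp
  also have "\<dots> = - ((-1) ^ n) * g * C
      - ((-1) ^ n) * g * K * of_real (real (n + 1) * \<mu> * h / b')"
  proof -
    have inv: "complex_of_real (b' / (real (n + 1) * \<mu> * h)) * of_real (real (n + 1) * \<mu> * h / b') = 1"
      unfolding of_real_mult[symmetric] using nz \<open>\<mu> > 0\<close> by simp
    have "- s * g * (K + x * C) * y = - s * g * C - s * g * K * y" if "x * y = 1" for s x y
    proof -
      have "- s * g * (K + x * C) * y = - s * g * K * y - s * g * C * (x * y)"
        by (simp add: algebra_simps)
      then show ?thesis using that by simp
    qed
    from this[OF inv] show ?thesis .
  qed
  also have "- ((-1) ^ n) * g * C = scaled_charlier \<mu> (Suc n) z"
    by (simp add: scaled_charlier_def g_def C_def del: charlier.simps)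
  also have "((-1) ^ n) * g * K * of_real (real (n + 1) * \<mu> * h / b') =
      - (of_real (real (n + 1) * \<mu> / diff_ratio \<mu> \<alpha> j n) / (of_nat n - z) * scaled_kernel \<mu> \<alpha> j n z)"
    unfolding scaled_kernel_def diff_ratio_def g b_def[symmetric] b'_def[symmetric] h_def[symmetric] K_def[symmetric]
    using nz by (simp add: divide_simps)
  finally show ?thesis by simp
qed

lemma scaled_diag_Suc:
  assumes "\<mu> > 0" "\<alpha> < 0" "j \<le> n"
  shows "scaled_diag \<mu> \<alpha> j lam (Suc n) = 1 + real (n + 1) * \<mu> / (diff_ratio \<mu> \<alpha> j n)\<^sup>2 * scaled_diag \<mu> \<alpha> j lam n"
proof -
  define b where "b = charlier_diff \<mu> \<alpha> j n"
  define b' where "b' = charlier_diff \<mu> \<alpha> j (Suc n)"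
  define h where "h = fact n * \<mu> ^ n"
  define K where "K = 1 / lam + kernel_diag \<mu> \<alpha> j (Suc n)"
  have nz: "b \<noteq> 0" "b' \<noteq> 0" "h \<noteq> 0"
    using assms charlier_diff_nonzero[OF assms(1,2)] by (simp_all add: b_def b'_def h_def)
  have h': "fact (Suc n) * \<mu> ^ Suc n = real (n + 1) * \<mu> * h"
    by (simp add: h_def)
  have K': "1 / lam + kernel_diag \<mu> \<alpha> j (Suc (Suc n)) = K + b'\<^sup>2 / (real (n + 1) * \<mu> * h)"
    unfolding K_def kernel_diag_def b'_def h'[symmetric] by simp
  show ?thesis
    unfolding scaled_diag_def diff_ratio_def h' K' b_def[symmetric] b'_def[symmetric] h_def[symmetric] K_def[symmetric]
    using nz \<open>\<mu> > 0\<close> by (simp add: divide_simps power2_eq_square)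
qed

text \<open>The recurrence has no second variable, so it is treated as a recurrence on a one-point space.\<close>

lemma scaled_diag_limit:
  assumes "\<mu> > 0" "\<alpha> < 0"
  shows "scaled_diag \<mu> \<alpha> j lam \<longlonglongrightarrow> 1"
    and "(\<lambda>n. real (n + 1) * (scaled_diag \<mu> \<alpha> j lam n - 1)) \<longlonglongrightarrow> \<mu>"
proof -
  define e where "e = diff_ratio \<mu> \<alpha> j"
  have "(\<lambda>n. real (n + 2) / real (n + 1)) \<longlonglongrightarrow> 1"
    by real_asymp
  then have "(\<lambda>n. real (n + 2) / real (n + 1) * (real (n + 1) / e n)\<^sup>2 * \<mu>) \<longlonglongrightarrow> 1 * 1\<^sup>2 * \<mu>"
    unfolding e_def by (intro tendsto_intros diff_ratio_inverse_asymptotics assms)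
  also have "(\<lambda>n. real (n + 2) / real (n + 1) * (real (n + 1) / e n)\<^sup>2 * \<mu>) =
      (\<lambda>n. real (n + 2) * (real (n + 1) * \<mu> / (e n)\<^sup>2))"
    by (rule ext) (simp add: power2_eq_square field_simps del: of_nat_Suc of_nat_add)
  finally have \<sigma>: "uniform_limit {()} (\<lambda>n _. of_nat (n + 2) * (real (n + 1) * \<mu> / (e n)\<^sup>2)) (\<lambda>_. \<mu>) sequentially"
    by simp
  note lim = uniform_limit_perturbed_recurrence[of j "{()}" "\<lambda>n _. scaled_diag \<mu> \<alpha> j lam n" "\<lambda>_ _. 1"
      "\<lambda>n _. real (n + 1) * \<mu> / (e n)\<^sup>2" "\<lambda>_. 1" \<mu>, OF _ _ _ \<sigma>]
  show "scaled_diag \<mu> \<alpha> j lam \<longlonglongrightarrow> 1"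
    using lim(1) by (simp add: scaled_diag_Suc[OF assms] e_def)
  show "(\<lambda>n. real (n + 1) * (scaled_diag \<mu> \<alpha> j lam n - 1)) \<longlonglongrightarrow> \<mu>"
    using lim(2) by (simp add: scaled_diag_Suc[OF assms] e_def)
qed

lemma scaled_kernel_limit:
  assumes "\<mu> > 0" "\<alpha> < 0" "compact K"
  shows "uniform_limit K (scaled_kernel \<mu> \<alpha> j) (charlier_limit \<mu>) sequentially"
    and "uniform_limit K (\<lambda>n z. of_nat (n + 1) * (scaled_kernel \<mu> \<alpha> j n z - scaled_charlier \<mu> n z))
      (\<lambda>z. of_real \<mu> * charlier_limit \<mu> z) sequentially"
proof -
  note bounded = compact_imp_bounded[OF \<open>compact K\<close>] bounded_charlier_limit[OF \<open>compact K\<close>]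
  define \<rho> where "\<rho> n z = of_real (real (n + 1) * \<mu> / diff_ratio \<mu> \<alpha> j n) / (of_nat n - z)"
    for n :: nat and z :: complex
  obtain R where R: "norm z \<le> R" if "z \<in> K" for z
    using bounded by (auto simp: bounded_iff)
  obtain N :: nat where N: "R < real N" "j \<le> N"
    by (metis max.cobounded1 max.cobounded2 of_nat_mono order.strict_trans2 reals_Archimedean2)
  have rec: "scaled_kernel \<mu> \<alpha> j (Suc n) z = scaled_charlier \<mu> (Suc n) z + \<rho> n z * scaled_kernel \<mu> \<alpha> j n z"
    if "N \<le> n" "z \<in> K" for n z
    unfolding \<rho>_def using R[OF that(2)] N that(1) by (intro scaled_kernel_Suc assms) auto
  have "(\<lambda>n. complex_of_real (real (n + 1) / diff_ratio \<mu> \<alpha> j n)) \<longlonglongrightarrow> of_real 1"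
    by (intro tendsto_of_real diff_ratio_inverse_asymptotics assms)
  then have "uniform_limit K (\<lambda>n z. (of_nat n + 2) / (of_nat n + 0 - z) * of_real \<mu>
      * of_real (real (n + 1) / diff_ratio \<mu> \<alpha> j n)) (\<lambda>z. 1 * of_real \<mu> * of_real 1) sequentially"
    by (intro uniform_lim_mult uniform_limit_ratio_one uniform_limit_const uniform_limit_of_tendsto bounded)
      (auto simp: image_constant_conv)
  then have \<rho>: "uniform_limit K (\<lambda>n z. of_nat (n + 2) * \<rho> n z) (\<lambda>_. of_real \<mu>) sequentially"
    by (simp add: \<rho>_def mult_ac add_ac)
  have bounded_kernel: "bounded (scaled_kernel \<mu> \<alpha> j n ` K)" for n
    unfolding scaled_kernel_def kernel_fun_def using \<open>compact K\<close>
    by (intro compact_imp_bounded compact_continuous_image continuous_intros continuous_on_rGamma_minus)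
  note lim = uniform_limit_perturbed_recurrence[OF rec scaled_charlier_limit[OF \<open>compact K\<close>] bounded(2) \<rho> bounded_kernel]
  show "uniform_limit K (scaled_kernel \<mu> \<alpha> j) (charlier_limit \<mu>) sequentially"
    using lim(1) .
  show "uniform_limit K (\<lambda>n z. of_nat (n + 1) * (scaled_kernel \<mu> \<alpha> j n z - scaled_charlier \<mu> n z))
      (\<lambda>z. of_real \<mu> * charlier_limit \<mu> z) sequentially"
    using lim(2) .
qed

section \<open>Asymptotics of the Sobolev type polynomials\<close>

text \<open>In the quotient of the two scaled sums the norm \<open>n! \<mu>\<^sup>n\<close> and one power of the difference at
\<open>\<alpha>\<close> cancel; the power that remains cancels against the denominator of the ratio of consecutive
differences, which leaves the numerator that the kernel formula asks for.\<close>

lemma scaled_sobolev: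
  assumes "\<mu> > 0" "\<alpha> < 0" "lam > 0" "j \<le> n" "of_nat n \<noteq> z"
    and S: "monic_orthogonal_seq (charlier_sobolev_inner \<mu> \<alpha> lam j) S"
  shows "(-1) ^ Suc n * rGamma (of_nat (Suc n) - z) * poly (map_poly complex_of_real (S (Suc n))) z
    = scaled_charlier \<mu> (Suc n) z - of_real (diff_ratio \<mu> \<alpha> j n) / (of_nat n - z)
        * scaled_kernel \<mu> \<alpha> j n z / of_real (scaled_diag \<mu> \<alpha> j lam n)"
proof -
  define b where "b = charlier_diff \<mu> \<alpha> j n"
  define b' where "b' = charlier_diff \<mu> \<alpha> j (Suc n)"
  define h where "h = fact n * \<mu> ^ n"
  define g where "g = rGamma (of_nat (Suc n) - z)"
  define K where "K = kernel_fun \<mu> \<alpha> j (Suc n) z"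
  define D where "D = 1 / lam + kernel_diag \<mu> \<alpha> j (Suc n)"
  have "kernel_diag \<mu> \<alpha> j (Suc n) \<ge> 0"
    unfolding kernel_diag_def using \<open>\<mu> > 0\<close> by (intro sum_nonneg) simp
  then have nz: "b \<noteq> 0" "h \<noteq> 0" "of_nat n - z \<noteq> 0" "D \<noteq> 0"
    using assms charlier_diff_nonzero[OF assms(1,2)]
    by (simp_all add: b_def h_def D_def add_pos_nonneg less_imp_neq[symmetric])
  have g: "rGamma (of_nat n - z) = (of_nat n - z) * g"
    unfolding g_def by (rule rGamma_step)
  have "(-1) ^ Suc n * g * poly (map_poly complex_of_real (S (Suc n))) z
      = scaled_charlier \<mu> (Suc n) z + (-1) ^ n * g * of_real (b' / D) * K"
    unfolding charlier_sobolev_kernel_formula[OF assms(1,3) S, of "Suc n"] poly_map_kernel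
      scaled_charlier_def D_def K_def b'_def g_def
    by (simp add: algebra_simps del: charlier.simps of_nat_Suc of_real_divide)
  also have "(-1) ^ n * g * of_real (b' / D) * K = - (of_real (diff_ratio \<mu> \<alpha> j n) / (of_nat n - z)
        * scaled_kernel \<mu> \<alpha> j n z / of_real (scaled_diag \<mu> \<alpha> j lam n))"
    unfolding scaled_kernel_def scaled_diag_def diff_ratio_def g
      b_def[symmetric] b'_def[symmetric] h_def[symmetric] K_def[symmetric] D_def[symmetric]
    using nz by (simp add: divide_simps power2_eq_square)
  finally show ?thesis by (simp add: g_def)
qed

theorem theorem4p9:
  fixes \<mu> \<alpha> lam :: real and j :: nat and S :: "nat \<Rightarrow> real poly"
  assumes "\<mu> > 0" and "\<alpha> < 0" and "lam > 0" and "j \<ge> 1"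
    and "monic_orthogonal_seq (charlier_sobolev_inner \<mu> \<alpha> lam j) S"
  shows "\<forall>K :: complex set. compact K \<longrightarrow>
    uniform_limit K
      (\<lambda>n z. (-1) ^ n * of_nat n * rGamma (of_nat n - z) * poly (map_poly complex_of_real (S n)) z)
      (\<lambda>z. - (z - complex_of_real \<alpha>) * complex_of_real (exp \<mu>) * rGamma (- z))
      sequentially"
proof (intro allI impI)
  fix K :: "complex set" assume "compact K"
  note bounded = compact_imp_bounded[OF \<open>compact K\<close>] bounded_charlier_limit[OF \<open>compact K\<close>]
  define A where "A = scaled_charlier \<mu>"
  define U where "U = scaled_kernel \<mu> \<alpha> j"
  define V where "V n = complex_of_real (scaled_diag \<mu> \<alpha> j lam n)" for n
  define e where "e = diff_ratio \<mu> \<alpha> j"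
  define G where "G = charlier_limit \<mu>"
  have A: "uniform_limit K A G sequentially"
    unfolding A_def G_def by (rule scaled_charlier_limit[OF \<open>compact K\<close>])
  have incr: "uniform_limit K (\<lambda>n z. of_nat (Suc n) * (A (Suc n) z - A n z)) (\<lambda>_. 0) sequentially"
    using scaled_charlier_increment_null[OF \<open>compact K\<close> A[unfolded A_def G_def]] unfolding A_def .
  note U = scaled_kernel_limit[OF assms(1,2) \<open>compact K\<close>, of j, folded U_def A_def G_def]
  have V: "uniform_limit K (\<lambda>n z. inverse (V n)) (\<lambda>_. 1) sequentially"
    using tendsto_inverse[OF tendsto_of_real[OF scaled_diag_limit(1)[OF assms(1,2), of j lam]], where 'a = complex]
    by (intro uniform_limit_of_tendsto) (simp add: V_def)
  have V': "uniform_limit K (\<lambda>n z. of_nat (n + 1) * (V n - 1)) (\<lambda>_. of_real \<mu>) sequentially"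
    using tendsto_of_real[OF scaled_diag_limit(2)[OF assms(1,2), of j lam], where 'a = complex]
    by (intro uniform_limit_of_tendsto) (simp add: V_def)
  have e: "uniform_limit K (\<lambda>n z. complex_of_real (- (e n - real n))) (\<lambda>_. of_real (- (- \<alpha>))) sequentially"
    unfolding e_def
    by (intro uniform_limit_of_tendsto tendsto_of_real tendsto_minus diff_ratio_asymptotics assms)
  have bounded_G: "bounded (G ` K)" using bounded by (simp add: G_def)
  have bounded_shift: "bounded ((\<lambda>z. c - z) ` K)" for c :: complex
    using \<open>compact K\<close> by (intro compact_imp_bounded compact_continuous_image continuous_intros)
  have bounded_mult: "bounded ((\<lambda>z. f z * g z) ` K)" if f: "bounded (f ` K)" and g: "bounded (g ` K)" for f g :: "complex \<Rightarrow> complex"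
  proof -
    obtain a b where "norm (f z) \<le> a" "norm (g z) \<le> b" if "z \<in> K" for z
      using f g unfolding bounded_iff ball_simps by metis
    then have "\<forall>z\<in>K. norm (f z * g z) \<le> a * b"
      by (auto simp: norm_mult intro!: mult_mono intro: order.trans[OF norm_ge_zero])
    then show ?thesis by (auto simp: bounded_iff)
  qed
  have bounded_const: "bounded ((\<lambda>z. c) ` K)" for c :: complex
    by (auto simp: image_constant_conv)
  \<comment> \<open>The scaled polynomial of degree \<open>n + 1\<close>, multiplied by \<open>n + 1\<close>, is split into the increment of
    \<open>A\<close>, the difference between \<open>A\<close> and \<open>U / V\<close>, and the deviation of \<open>e n / (n - z)\<close> from \<open>1\<close>.
    In the second part the two corrections of relative size \<open>\<mu> / n\<close> cancel.\<close>
  have "uniform_limit K (\<lambda>n z.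
        of_nat (Suc n) * (A (Suc n) z - A n z)
        + (A n z * (of_nat (n + 1) * (V n - 1)) - of_nat (n + 1) * (U n z - A n z)) * inverse (V n)
        + ((of_nat n + 1) / (of_nat n + 0 - z) * (of_real (- (e n - real n)) - z)) * (U n z * inverse (V n)))
      (\<lambda>z. 0 + (G z * of_real \<mu> - of_real \<mu> * G z) * 1 + (1 * (of_real (- (- \<alpha>)) - z)) * (G z * 1)) sequentially"
    by (intro uniform_limit_add uniform_limit_minus uniform_lim_mult incr A U V V' e uniform_limit_const
        uniform_limit_ratio_one bounded bounded_shift bounded_const bounded_mult bounded_G
        bounded_minus_comp)
  moreover have "\<forall>\<^sub>F n in sequentially. \<forall>z\<in>K.
        of_nat (Suc n) * (A (Suc n) z - A n z)
        + (A n z * (of_nat (n + 1) * (V n - 1)) - of_nat (n + 1) * (U n z - A n z)) * inverse (V n)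
        + ((of_nat n + 1) / (of_nat n + 0 - z) * (of_real (- (e n - real n)) - z)) * (U n z * inverse (V n))
      = (-1) ^ Suc n * of_nat (Suc n) * rGamma (of_nat (Suc n) - z) * poly (map_poly complex_of_real (S (Suc n))) z"
  proof -
    obtain R where R: "norm z \<le> R" if "z \<in> K" for z
      using bounded by (auto simp: bounded_iff)
    have "\<forall>\<^sub>F n in sequentially. R < real n"
      by real_asymp
    moreover have "\<forall>\<^sub>F n in sequentially. scaled_diag \<mu> \<alpha> j lam n > 0"
      using scaled_diag_limit(1)[OF assms(1,2)] by (rule order_tendstoD) simp
    moreover have "\<forall>\<^sub>F n in sequentially. j \<le> n"
      by (rule eventually_ge_at_top)
    ultimately show ?thesis
    proof eventually_elim
      case (elim n)
      have V_nz: "V n \<noteq> 0" using elim by (simp add: V_def)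
      show ?case
      proof
        fix z assume "z \<in> K"
        then have nz: "of_nat n \<noteq> z" using elim R[of z] by auto
        define w where "w = of_nat n - z"
        have "w \<noteq> 0" using nz by (simp add: w_def)
        have S_eq: "(-1) ^ Suc n * rGamma (of_nat (Suc n) - z) * poly (map_poly complex_of_real (S (Suc n))) z
            = A (Suc n) z - of_real (e n) / w * U n z / V n"
          unfolding A_def U_def V_def e_def w_def
          by (rule scaled_sobolev[OF assms(1-3) _ nz assms(5)]) (use elim in simp)
        have z: "of_real (- (e n - real n)) - z = w - of_real (e n)" "of_nat n + 0 - z = w"
          by (simp_all add: w_def)
        have "of_nat (Suc n) * (A (Suc n) z - A n z)
            + (A n z * (of_nat (n + 1) * (V n - 1)) - of_nat (n + 1) * (U n z - A n z)) * inverse (V n)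
            + ((of_nat n + 1) / w * (w - of_real (e n))) * (U n z * inverse (V n))
          = of_nat (Suc n) * (A (Suc n) z - of_real (e n) / w * U n z / V n)"
          using V_nz \<open>w \<noteq> 0\<close> by (simp add: divide_simps) (simp add: algebra_simps)
        then show "of_nat (Suc n) * (A (Suc n) z - A n z)
            + (A n z * (of_nat (n + 1) * (V n - 1)) - of_nat (n + 1) * (U n z - A n z)) * inverse (V n)
            + ((of_nat n + 1) / (of_nat n + 0 - z) * (of_real (- (e n - real n)) - z)) * (U n z * inverse (V n))
          = (-1) ^ Suc n * of_nat (Suc n) * rGamma (of_nat (Suc n) - z) * poly (map_poly complex_of_real (S (Suc n))) z"
          unfolding z S_eq[symmetric] by (simp only: mult_ac)
      qed
    qed
  qed
  moreover have "0 + (G z * of_real \<mu> - of_real \<mu> * G z) * 1 + (1 * (of_real (- (- \<alpha>)) - z)) * (G z * 1)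
      = - (z - complex_of_real \<alpha>) * complex_of_real (exp \<mu>) * rGamma (- z)" for z
    by (simp add: G_def charlier_limit_def)
  ultimately have "uniform_limit K
      (\<lambda>n z. (-1) ^ Suc n * of_nat (Suc n) * rGamma (of_nat (Suc n) - z) * poly (map_poly complex_of_real (S (Suc n))) z)
      (\<lambda>z. - (z - complex_of_real \<alpha>) * complex_of_real (exp \<mu>) * rGamma (- z)) sequentially"
    by (rule uniform_limit_cong[THEN iffD1, rotated 2])
  then show "uniform_limit K
      (\<lambda>n z. (-1) ^ n * of_nat n * rGamma (of_nat n - z) * poly (map_poly complex_of_real (S n)) z)
      (\<lambda>z. - (z - complex_of_real \<alpha>) * complex_of_real (exp \<mu>) * rGamma (- z))
      sequentially"
    by (subst (asm) filterlim_sequentially_Suc)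
qed

end
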